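(* For all positive integers $n$ and $k$, $$\sum_{\lambda\in\Lambda_{n-1}^k} m_{n,k-\frac12}^{\lambda}\, s_{\lambda}(\boldsymbol{x})=\sum_{j=1}^{\min(n,k)} S(k,j)\, h_{(n-j,1^{j-1})}(\boldsymbol{x}).$$
   Context: Integer partitions are identified with their Young diagrams and ordered by containment; $\emptyset$ is the only partition of $0$ (its first part is taken to be $0$). $\Lambda_{n-1}^k=\{\lambda\vdash n-1:\ \lambda_1\ge n-1-k\}$. An $n$-vacillating tableau of shape $\lambda$ and length $2k-1$ is a sequence of $2k$ integer partitions $((n)=\lambda^{(0)},\lambda^{(1/2)},\lambda^{(1)},\dots,\lambda^{(k-1)},\lambda^{(k-1/2)}=\lambda)$ such that (a) for each integer $j=0,\dots,k-1$: $\lambda^{(j)}\supseteq\lambda^{(j+1/2)}$ and $|\lambda^{(j)}/\lambda^{(j+1/2)}|=1$; (b) for each integer $j=0,\dots,k-2$: $\lambda^{(j+1/2)}\subseteq\lambda^{(j+1)}$ and $|\lambda^{(j+1)}/\lambda^{(j+1/2)}|=1$. $m_{n,k-\frac12}^{\lambda}$ is the number of $n$-vacillating tableaux of shape $\lambda$ and length $2k-1$. $s_\lambda(\boldsymbol{x})$ is the Schur function in $\boldsymbol{x}=(x_1,x_2,\dots)$, with $s_\emptyset=1$. $S(k,j)$ is the Stirling number of the second kind. $h_0=1$, $h_r=\sum_{i_1\le\cdots\le i_r}x_{i_1}\cdots x_{i_r}$ for $r\ge1$, and $h_\lambda=h_{\lambda_1}h_{\lambda_2}\cdots$ (complete symmetric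 functions); so $h_{(n-j,1^{j-1})}=h_{n-j}h_1^{j-1}$, where for $j=n$ the partition $(n-j,1^{j-1})$ is $(1^{n-1})$. *)

theory Defs
  imports
    Main
    "HOL-Library.FuncSet"
    "HOL-Library.Poly_Mapping"
    "HOL-Combinatorics.Stirling"
begin

section \<open>Formal power series in countably many variables\<close>

text \<open>
  A monomial is an exponent vector of finite support; the index \<open>i :: nat\<close> stands for the
  variable usually written $x_{i+1}$. A series is its family of integer coefficients, with the
  usual Cauchy product. The ring of symmetric functions over the integers is a subring.
\<close>

type_synonym monomial = "nat \<Rightarrow>\<^sub>0 nat"

typedef series = "UNIV :: (monomial \<Rightarrow> int) set"
  morphisms coeff Series by simp

lemma coeff_Series [simp]: "coeff (Series f) = f"
  by (simp add: Series_inverse)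

lemma series_eqI: "(\<And>m. coeff f m = coeff g m) \<Longrightarrow> f = g"
  by (simp add: coeff_inject [symmetric] fun_eq_iff)

lemma finite_monomial_splits: "finite {(a, b). a + b = (m :: monomial)}"
proof -
  let ?F = "\<lambda>f::nat \<Rightarrow> nat. f \<in> {g. \<forall>i. (i \<in> Poly_Mapping.keys m \<longrightarrow> g i \<in> {..Max (range (Poly_Mapping.lookup m))})
              \<and> (i \<notin> Poly_Mapping.keys m \<longrightarrow> g i = 0)}"
  have fr: "finite (range (Poly_Mapping.lookup m))"
  proof -
    have "range (Poly_Mapping.lookup m) \<subseteq> insert 0 (Poly_Mapping.lookup m ` Poly_Mapping.keys m)"
      by (auto simp: in_keys_iff)
    then show ?thesis
      by (rule finite_subset) simp
  qed
  have fin: "finite {f. ?F f}"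
    using finite_set_of_finite_funs [of "Poly_Mapping.keys m" "{..Max (range (Poly_Mapping.lookup m))}" 0]
    by simp
  have part: "?F (Poly_Mapping.lookup a)" if "a + b = m" for a b
  proof -
    have le: "Poly_Mapping.lookup a i \<le> Poly_Mapping.lookup m i" for i
      using that by (auto simp: lookup_add)
    have "Poly_Mapping.lookup m i \<le> Max (range (Poly_Mapping.lookup m))" for i
      using fr by (intro Max_ge) auto
    then have le': "Poly_Mapping.lookup a i \<le> Max (range (Poly_Mapping.lookup m))" for i
      using le order_trans by blast
    have "Poly_Mapping.lookup a i = 0" if "i \<notin> Poly_Mapping.keys m" for i
      using that le [of i] by (simp add: in_keys_iff)
    with le' show ?thesis by simp
  qed
  define A where "A = {a. \<exists>b. a + b = m}"
  have "finite (Poly_Mapping.lookup ` A)"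
    by (rule finite_subset [OF _ fin]) (use part in \<open>auto simp: A_def\<close>)
  then have "finite A"
    by (rule finite_imageD) (simp add: inj_on_def poly_mapping_eqI)
  moreover have "{(a, b). a + b = m} \<subseteq> A \<times> A"
    by (auto simp: A_def) (metis add.commute)
  ultimately show ?thesis
    by (meson finite_SigmaI finite_subset)
qed

instantiation series :: comm_ring_1
begin

definition zero_series :: series where
  "0 = Series (\<lambda>m. 0)"

definition one_series :: series where
  "1 = Series (\<lambda>m. if m = 0 then 1 else 0)"

definition plus_series :: "series \<Rightarrow> series \<Rightarrow> series" where
  "f + g = Series (\<lambda>m. coeff f m + coeff g m)"

definition minus_series :: "series \<Rightarrow> series \<Rightarrow> series" where
  "f - g = Series (\<lambda>m. coeff f m - coeff g m)"

definition uminus_series :: "series \<Rightarrow> series" where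
  "- f = Series (\<lambda>m. - coeff f m)"

definition times_series :: "series \<Rightarrow> series \<Rightarrow> series" where
  "f * g = Series (\<lambda>m. \<Sum>(a, b)\<in>{(a, b). a + b = m}. coeff f a * coeff g b)"

instance
proof
  fix f g h :: series
  show "f + g + h = f + (g + h)" "f + g = g + f" "0 + f = f" "- f + f = 0" "f - g = f + - g"
    by (rule series_eqI; simp add: plus_series_def zero_series_def uminus_series_def minus_series_def)+
  show "(0::series) \<noteq> 1"
  proof
    assume "(0::series) = 1"
    then have "coeff 0 0 = coeff 1 0" by simp
    then show False by (simp add: zero_series_def one_series_def)
  qed
  show "f * g = g * f"
    unfolding times_series_def
    by (intro arg_cong [where f = Series] ext sum.reindex_bij_witness [of _ prod.swap prod.swap])
      (auto simp: add.commute mult.commute)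
  show "(f + g) * h = f * h + g * h"
    by (rule series_eqI)
      (simp add: times_series_def plus_series_def distrib_right sum.distrib case_prod_beta)
  show "1 * f = f"
  proof (rule series_eqI)
    fix m
    have "coeff (1 * f) m = (\<Sum>p\<in>{(a, b). a + b = m}. if p = (0, m) then coeff f m else 0)"
      by (auto simp: times_series_def one_series_def intro!: sum.cong)
    also have "\<dots> = coeff f m"
      by (subst sum.delta) (simp_all add: finite_monomial_splits)
    finally show "coeff (1 * f) m = coeff f m" .
  qed
  show "f * g * h = f * (g * h)"
  proof (rule series_eqI)
    fix m
    let ?S = "\<lambda>m. {(a, b). a + b = (m :: monomial)}"
    have "coeff (f * g * h) m =
        (\<Sum>p\<in>?S m. \<Sum>q\<in>?S (fst p). coeff f (fst q) * coeff g (snd q) * coeff h (snd p))"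
      by (simp add: times_series_def case_prod_beta sum_distrib_right)
    also have "\<dots> = (\<Sum>(p, q)\<in>(SIGMA p:?S m. ?S (fst p)). coeff f (fst q) * coeff g (snd q) * coeff h (snd p))"
      by (rule sum.Sigma) (simp_all add: finite_monomial_splits)
    also have "\<dots> = (\<Sum>(p, q)\<in>(SIGMA p:?S m. ?S (snd p)). coeff f (fst p) * (coeff g (fst q) * coeff h (snd q)))"
      by (rule sum.reindex_bij_witness
          [of _ "\<lambda>(p, q). ((fst p + fst q, snd q), (fst p, fst q))"
                "\<lambda>(p, q). ((fst q, snd q + snd p), (snd q, snd p))"])
        (auto simp: add.assoc mult.assoc)
    also have "\<dots> = (\<Sum>p\<in>?S m. \<Sum>q\<in>?S (snd p). coeff f (fst p) * (coeff g (fst q) * coeff h (snd q)))"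
      by (rule sum.Sigma [symmetric]) (simp_all add: finite_monomial_splits)
    also have "\<dots> = coeff (f * (g * h)) m"
      by (simp add: times_series_def case_prod_beta sum_distrib_left)
    finally show "coeff (f * g * h) m = coeff (f * (g * h)) m" .
  qed
qed

end

text \<open>
  The possibly infinite sum of the monomials \<open>w a\<close> for \<open>a \<in> A\<close>; it is
  meaningful only if every monomial arises from finitely many \<open>a\<close>, as in all uses below.
\<close>

definition monomial_sum :: "'a set \<Rightarrow> ('a \<Rightarrow> monomial) \<Rightarrow> series" where
  "monomial_sum A w = Series (\<lambda>m. int (card {a \<in> A. w a = m}))"

abbreviation var :: "nat \<Rightarrow> monomial" where
  "var i \<equiv> Poly_Mapping.single i 1"

lemma keys_sum_var: "finite C \<Longrightarrow> Poly_Mapping.keys (\<Sum>c\<in>C. var (T c)) = T ` C"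
proof (induction C rule: finite_induct)
  case (insert c C)
  have "Poly_Mapping.keys (var (T c) + (\<Sum>c\<in>C. var (T c)))
      = Poly_Mapping.keys (var (T c)) \<union> Poly_Mapping.keys (\<Sum>c\<in>C. var (T c))"
    unfolding set_eq_iff by (auto simp: in_keys_iff lookup_add lookup_single when_def)
  with insert show ?case by simp
qed simp


section \<open>Integer partitions\<close>

definition partitions :: "nat \<Rightarrow> nat list set" where
  "partitions n = {l. sorted_wrt (\<ge>) l \<and> 0 \<notin> set l \<and> sum_list l = n}"

definition diagram :: "nat list \<Rightarrow> (nat \<times> nat) set" where
  "diagram l = {(i, j). i < length l \<and> j < l ! i}"

definition first_part :: "nat list \<Rightarrow> nat" where
  "first_part l = (if l = [] then 0 else hd l)"

definition Lambda :: "nat \<Rightarrow> nat \<Rightarrow> nat list set" where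
  "Lambda m k = {l \<in> partitions m. int (first_part l) \<ge> int m - int k}"

lemma finite_diagram [simp]: "finite (diagram l)"
proof -
  have "diagram l = (SIGMA i:{..<length l}. {..<l ! i})"
    by (auto simp: diagram_def)
  then show ?thesis by simp
qed

lemma finite_partitions [simp]: "finite (partitions n)"
proof -
  have "length l \<le> sum_list l" if "0 \<notin> set l" for l :: "nat list"
    using that by (induction l) auto
  then have "partitions n \<subseteq> {l. set l \<subseteq> {..n} \<and> length l \<le> n}"
    by (auto simp: partitions_def member_le_sum_list)
  then show ?thesis
    by (rule finite_subset) (simp add: finite_lists_length_le)
qed

lemma finite_Lambda [simp]: "finite (Lambda m k)"
  by (simp add: Lambda_def)


section \<open>Vacillating tableaux\<close>

text \<open>
  The list \<open>t\<close> holds the sequence at doubled positions: \<open>t ! (2 * j)\<close> is the partition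
  at position $j$ and \<open>t ! (2 * j + 1)\<close> the one at position $j + 1/2$. The length of the
  tableau is $2k - 1$, that of the list $2k$.
\<close>

definition one_box_below :: "nat list \<Rightarrow> nat list \<Rightarrow> bool" where
  "one_box_below m l \<longleftrightarrow> diagram m \<subseteq> diagram l \<and> card (diagram l - diagram m) = 1"

definition vacillating_tableaux :: "nat \<Rightarrow> nat \<Rightarrow> nat list \<Rightarrow> nat list list set" where
  "vacillating_tableaux n k l = {t. length t = 2 * k \<and>
     (\<forall>p\<in>set t. \<exists>m. p \<in> partitions m) \<and>
     t ! 0 = [n] \<and> t ! (2 * k - 1) = l \<and>
     (\<forall>j<k. one_box_below (t ! (2 * j + 1)) (t ! (2 * j))) \<and>
     (\<forall>j. j + 1 < k \<longrightarrow> one_box_below (t ! (2 * j + 1)) (t ! (2 * j + 2)))}"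

definition vacillating_count :: "nat \<Rightarrow> nat \<Rightarrow> nat list \<Rightarrow> nat" where
  "vacillating_count n k l = card (vacillating_tableaux n k l)"

lemma card_diagram: "card (diagram l) = sum_list l"
proof -
  have "diagram l = (SIGMA i:{..<length l}. {..<l ! i})"
    by (auto simp: diagram_def)
  then show ?thesis
    by (simp add: sum_list_sum_nth atLeast0LessThan)
qed

lemma one_box_below_sum_list: "one_box_below m l \<Longrightarrow> sum_list l = sum_list m + 1"
  unfolding one_box_below_def
  by (metis card_Diff_subset card_diagram card_mono finite_diagram le_add_diff_inverse)

lemma finite_vacillating_tableaux: "finite (vacillating_tableaux n k l)"
proof -
  have "t \<in> {t. set t \<subseteq> (\<Union>m\<le>n. partitions m) \<and> length t = 2 * k}"
    if t: "t \<in> vacillating_tableaux n k l" for t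
  proof -
    have down: "sum_list (t ! (2 * j)) = sum_list (t ! (2 * j + 1)) + 1" if "j < k" for j
      by (rule one_box_below_sum_list) (use t that in \<open>simp add: vacillating_tableaux_def\<close>)
    have up: "sum_list (t ! (2 * j + 2)) = sum_list (t ! (2 * j + 1)) + 1" if "j + 1 < k" for j
      by (rule one_box_below_sum_list) (use t that in \<open>simp add: vacillating_tableaux_def\<close>)
    have even: "sum_list (t ! (2 * j)) = n" if "j < k" for j
      using that
    proof (induction j)
      case 0
      then show ?case using t by (simp add: vacillating_tableaux_def)
    next
      case (Suc j)
      then show ?case using up [of j] down [of j] by simp
    qed
    have "sum_list (t ! i) \<le> n" if "i < 2 * k" for i
    proof (cases "even i")
      case True
      then obtain j where "i = 2 * j" by blast
      then show ?thesis using even [of j] that by simp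
    next
      case False
      then obtain j where "i = 2 * j + 1" by (elim oddE)
      then show ?thesis using even [of j] down [of j] that by simp
    qed
    moreover have "length t = 2 * k" "\<forall>p\<in>set t. \<exists>m. p \<in> partitions m"
      using t by (auto simp: vacillating_tableaux_def)
    ultimately show ?thesis
      by (fastforce simp: partitions_def in_set_conv_nth)
  qed
  then have "vacillating_tableaux n k l \<subseteq> {t. set t \<subseteq> (\<Union>m\<le>n. partitions m) \<and> length t = 2 * k}"
    by (rule subsetI)
  then show ?thesis
    by (rule finite_subset) (simp add: finite_lists_length_eq)
qed


section \<open>Schur and complete symmetric functions\<close>

text \<open>
  Rows are indexed downwards and columns to the right, so entries of a semistandard tableau
  increase weakly in the second and strictly in the first coordinate.
\<close>

definition semistandard_tableaux :: "nat list \<Rightarrow> (nat \<times> nat \<Rightarrow> nat) set" where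
  "semistandard_tableaux l = {T \<in> diagram l \<rightarrow>\<^sub>E UNIV.
     (\<forall>i j. (i, j + 1) \<in> diagram l \<longrightarrow> T (i, j) \<le> T (i, j + 1)) \<and>
     (\<forall>i j. (i + 1, j) \<in> diagram l \<longrightarrow> T (i, j) < T (i + 1, j))}"

definition schur :: "nat list \<Rightarrow> series" where
  "schur l = monomial_sum (semistandard_tableaux l) (\<lambda>T. \<Sum>c\<in>diagram l. var (T c))"

definition complete_sym :: "nat \<Rightarrow> series" where
  "complete_sym r = monomial_sum {xs. length xs = r \<and> sorted xs} (\<lambda>xs. \<Sum>i\<leftarrow>xs. var i)"

definition complete_sym_partition :: "nat list \<Rightarrow> series" where
  "complete_sym_partition l = (\<Prod>r\<leftarrow>l. complete_sym r)"

definition near_hook :: "nat \<Rightarrow> nat \<Rightarrow> nat list" where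
  "near_hook n j = (if j = n then replicate (n - 1) 1 else (n - j) # replicate (j - 1) 1)"

lemma finite_semistandard_content:
  "finite {T \<in> semistandard_tableaux l. (\<Sum>c\<in>diagram l. var (T c)) = m}"
proof (rule finite_subset)
  show "{T \<in> semistandard_tableaux l. (\<Sum>c\<in>diagram l. var (T c)) = m}
      \<subseteq> diagram l \<rightarrow>\<^sub>E Poly_Mapping.keys m"
    by (auto simp: semistandard_tableaux_def keys_sum_var PiE_iff extensional_def simp del: One_nat_def)
  show "finite (diagram l \<rightarrow>\<^sub>E Poly_Mapping.keys m)"
    by (simp add: finite_PiE)
qed

lemma finite_sorted_content:
  "finite {xs \<in> {xs. length xs = r \<and> sorted xs}. (\<Sum>i\<leftarrow>xs. var i) = m}"
proof (rule finite_subset)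
  have "set xs \<subseteq> Poly_Mapping.keys (\<Sum>i\<leftarrow>xs. var i)" for xs
    by (induction xs) (auto simp: in_keys_iff lookup_add)
  then show "{xs \<in> {xs. length xs = r \<and> sorted xs}. (\<Sum>i\<leftarrow>xs. var i) = m}
      \<subseteq> {xs. set xs \<subseteq> Poly_Mapping.keys m \<and> length xs = r}"
    by auto
  show "finite {xs. set xs \<subseteq> Poly_Mapping.keys m \<and> length xs = r}"
    by (simp add: finite_lists_length_eq)
qed

lemma complete_sym_0 [simp]: "complete_sym 0 = 1"
proof (rule series_eqI)
  fix m
  have "{xs \<in> {xs. length xs = 0 \<and> sorted xs}. (\<Sum>i\<leftarrow>xs. var i) = m} = (if m = 0 then {[]} else {})"
    by auto
  then show "coeff (complete_sym 0) m = coeff 1 m"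
    by (simp add: complete_sym_def monomial_sum_def one_series_def)
qed

lemma schur_Nil [simp]: "schur [] = 1"
proof (rule series_eqI)
  fix m
  have "diagram [] = {}" by (simp add: diagram_def)
  then have "{T \<in> semistandard_tableaux []. (\<Sum>c\<in>diagram []. var (T c)) = m}
      = (if m = 0 then {\<lambda>c. undefined} else {})"
    by (auto simp: semistandard_tableaux_def)
  then show "coeff (schur []) m = coeff 1 m"
    by (simp add: schur_def monomial_sum_def one_series_def)
qed

lemma complete_sym_near_hook:
  assumes "1 \<le> j" "j \<le> n"
  shows "complete_sym_partition (near_hook n j) = complete_sym (n - j) * complete_sym 1 ^ (j - 1)"
  using assms by (auto simp: complete_sym_partition_def near_hook_def prod_list_replicate)

end

theory Submission
  imports Defs
begin

text \<open>
  Let $G_k$ be the left side. A vacillating tableau of length $2k + 1$ arises from one of length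
  $2k - 1$ by adding a box and removing a box. On Schur functions, adding a box in all possible ways
  is multiplication by $h_1$ (Pieri's rule), and removing a box in all possible ways is the
  derivation $h_1^\perp$. Hence $G_{k+1} = h_1^\perp (h_1 G_k)$, and
  $G_1 = h_1^\perp h_n = h_{n-1}$. The derivation satisfies $h_1^\perp h_r = h_{r-1}$, so
  \[ h_1^\perp (h_1 \cdot h_{n-j} h_1^{j-1}) = j \, h_{n-j} h_1^{j-1} + h_{n-j-1} h_1^j , \]
  and the right side of the theorem obeys the same recursion because
  $S(k+1,j) = j\,S(k,j) + S(k,j-1)$.

  Both rules for Schur functions come from splitting off the last variable. The part of a symmetric
  function with exponent $r$ in the last variable $x_N$ is $h_r^\perp$ applied to it, in one variable
  less. For $s_\lambda$ it is the sum of the $s_\mu$ with $\lambda/\mu$ a horizontal strip of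
  size $r$ (\<open>slice_schur\<close>), because the entries $N$ of a semistandard tableau form such a strip;
  for $r = 1$ this removes a box. Products are split by \<open>slice_mult\<close>, which contains the Leibniz
  rule for $h_1^\perp$. Pieri's rule (\<open>pieri\<close>) then follows by induction on the number of
  variables; what remains there is a count of the ways to exchange adding a box with removing a
  horizontal strip (\<open>switch_box_strip\<close>).
\<close>

section \<open>Adding boxes and removing horizontal strips\<close>

definition all_partitions :: "nat list set" where
  "all_partitions = {l. sorted_wrt (\<ge>) l \<and> 0 \<notin> set l}"

lemma partitions_eq: "partitions n = {l \<in> all_partitions. sum_list l = n}"
  by (auto simp: partitions_def all_partitions_def)

text \<open>
  Padding with zeros turns adding a box into a pointwise update and interlacing into
  inequalities that hold for every index, without reference to lengths.
\<close>

definition part :: "nat list \<Rightarrow> nat \<Rightarrow> nat" where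
  "part l i = (if i < length l then l ! i else 0)"

lemma diagram_part: "diagram l = {(i, j). j < part l i}"
  by (auto simp: diagram_def part_def split: if_splits)

lemma part_eq_0_iff: "l \<in> all_partitions \<Longrightarrow> part l i = 0 \<longleftrightarrow> length l \<le> i"
  by (auto simp: part_def all_partitions_def) (metis gr0I nth_mem)

lemma antimono_part: "l \<in> all_partitions \<Longrightarrow> antimono (part l)"
  unfolding antimono_iff_le_Suc
  by (auto simp: part_def all_partitions_def sorted_wrt_iff_nth_less)

lemma part_inject:
  assumes "l \<in> all_partitions" "l' \<in> all_partitions" "part l = part l'"
  shows "l = l'"
proof (rule nth_equalityI)
  have "length l \<le> i \<longleftrightarrow> length l' \<le> i" for i
    using assms part_eq_0_iff by metis
  then show len: "length l = length l'"
    by (meson le_antisym order_refl)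
  fix i assume "i < length l"
  then show "l ! i = l' ! i"
    using fun_cong [OF assms(3), of i] len by (simp add: part_def)
qed

lemma ex_part:
  assumes "antimono f" "f b = (0::nat)"
  obtains l where "l \<in> all_partitions" "part l = f"
proof
  define n where "n = (LEAST i. f i = 0)"
  have n: "f n = 0" "\<And>i. i < n \<Longrightarrow> f i \<noteq> 0"
    unfolding n_def using assms(2) by (auto intro: LeastI dest: not_less_Least)
  have "f i = 0" if "n \<le> i" for i
    using antimonoD [OF assms(1) that] n(1) by simp
  then show "part (map f [0..<n]) = f"
    by (auto simp: part_def)
  show "map f [0..<n] \<in> all_partitions"
  proof -
    have "sorted_wrt (\<ge>) (map f [0..<n])"
      unfolding sorted_wrt_iff_nth_less by (simp add: antimonoD [OF assms(1)])
    moreover have "0 \<notin> set (map f [0..<n])"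
      using n(2) by (metis atLeastLessThan_iff imageE set_map set_upt)
    ultimately show ?thesis by (simp add: all_partitions_def)
  qed
qed

lemma diagram_mono_iff: "diagram m \<subseteq> diagram l \<longleftrightarrow> (\<forall>i. part m i \<le> part l i)"
proof
  assume *: "diagram m \<subseteq> diagram l"
  show "\<forall>i. part m i \<le> part l i"
  proof (rule allI, rule ccontr)
    fix i assume "\<not> part m i \<le> part l i"
    then have "(i, part l i) \<in> diagram m" by (simp add: diagram_part)
    with * show False by (auto simp: diagram_part)
  qed
qed (auto simp: diagram_part intro: less_le_trans)

definition add_box :: "(nat \<Rightarrow> nat) \<Rightarrow> nat \<Rightarrow> nat \<Rightarrow> nat" where
  "add_box f i = f(i := Suc (f i))"

lemma inj_add_box: "inj (add_box f)"
  by (rule injI) (metis add_box_def fun_upd_apply n_not_Suc_n)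

lemma one_box_below_iff: "one_box_below m l \<longleftrightarrow> (\<exists>i. part l = add_box (part m) i)"
proof
  assume *: "one_box_below m l"
  then obtain i j where ij: "diagram l - diagram m = {(i, j)}"
    unfolding one_box_below_def by (metis card_1_singletonE surj_pair)
  have le: "part m i' \<le> part l i'" for i'
    using * by (simp add: one_box_below_def diagram_mono_iff)
  have D: "part m i' \<le> j' \<and> j' < part l i' \<longleftrightarrow> i' = i \<and> j' = j" for i' j'
    using ij unfolding diagram_part set_eq_iff by (simp add: not_less conj_commute)
  have "part l i' = (if i' = i then Suc (part m i) else part m i')" for i'
  proof (cases "i' = i")
    case True
    have "part m i = j" "part l i - 1 = j"
      using D [of i "part m i"] D [of i "part l i - 1"] D [of i j] by auto
    with True D [of i j] show ?thesis by simp
  next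
    case False
    then show ?thesis using D [of i' "part m i'"] le [of i'] by auto
  qed
  then show "\<exists>i. part l = add_box (part m) i"
    by (intro exI [of _ i]) (auto simp: add_box_def)
next
  assume "\<exists>i. part l = add_box (part m) i"
  then obtain i where i: "part l = add_box (part m) i" by blast
  have "diagram l - diagram m = {(i, part m i)}"
    unfolding diagram_part i by (auto simp: add_box_def split: if_splits)
  moreover have "diagram m \<subseteq> diagram l"
    by (simp add: diagram_mono_iff i add_box_def)
  ultimately show "one_box_below m l"
    by (simp add: one_box_below_def)
qed

text \<open>
  For the parts $f$ of $\mu$ and $g$ of $\lambda$ this says that $\lambda/\mu$ is a horizontal
  strip: no two boxes of the difference lie in the same column.
\<close>

definition interlaces :: "(nat \<Rightarrow> nat) \<Rightarrow> (nat \<Rightarrow> nat) \<Rightarrow> bool" where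
  "interlaces f g \<longleftrightarrow> (\<forall>i. g (Suc i) \<le> f i \<and> f i \<le> g i)"

lemma interlaces_antimono:
  assumes "interlaces f g" shows "antimono f" "antimono g"
  using assms unfolding antimono_iff_le_Suc interlaces_def by (meson order_trans)+

lemma antimono_add_box_interlaces:
  assumes "antimono f" "antimono (add_box f i)"
  shows "interlaces f (add_box f i)"
  unfolding interlaces_def
proof
  fix j
  show "add_box f i (Suc j) \<le> f j \<and> f j \<le> add_box f i j"
    using antimonoD [OF assms(1), of j "Suc j"] antimonoD [OF assms(2), of j "Suc j"]
    by (cases "Suc j = i") (auto simp: add_box_def)
qed

text \<open>
  The combinatorial heart of Pieri's rule. Both sides vanish unless $f_{i+1} \le g_i$ for all $i$.
  Then, if $g \le f$ pointwise, a box can be added to $f$ in row $0$ or in a row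
  $i + 1$ with $f_{i+1} < g_i$, and it can be removed from $g$ in a row $i$ with
  $f_{i+1} < g_i$; shifting rows by one matches the two sides except for row $0$, which is
  paid by the term for $g$ interlacing $f$. If $g$ exceeds $f$ in a single row, and there by one,
  that row is the only choice on both sides. In all other cases both sides vanish.
\<close>

lemma interlacing_switch:
  assumes f: "antimono f" "f b = (0::nat)" and g: "antimono g" "g b = (0::nat)"
  shows "card {i. interlaces g (add_box f i)}
       = card {i. 0 < g i \<and> interlaces (g(i := g i - 1)) f} + (if interlaces g f then 1 else 0)"
    (is "card ?I = card ?J + _")
proof (cases "\<forall>j. f (Suc j) \<le> g j")
  case L: True
  show ?thesis
  proof (cases "\<forall>j. g j \<le> f j")
    case True
    let ?K = "{i. f (Suc i) < g i}"
    have "g i \<noteq> 0 \<Longrightarrow> i < b" for i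
      using antimonoD [OF g(1), of b i] g(2) by (cases "b \<le> i") auto
    then have fin: "finite ?K"
      by (intro finite_subset [of ?K "{..<b}"]) (auto simp: less_eq_Suc_le)
    have "?I = insert 0 (Suc ` ?K)"
    proof (intro set_eqI)
      fix i
      show "i \<in> ?I \<longleftrightarrow> i \<in> insert 0 (Suc ` ?K)"
      proof (cases i)
        case 0
        then show ?thesis using L True by (auto simp: interlaces_def add_box_def le_SucI)
      next
        case (Suc i')
        then show ?thesis using L True
          by (auto simp: interlaces_def add_box_def le_SucI Suc_le_eq image_iff)
      qed
    qed
    then have "card ?I = Suc (card ?K)"
      using fin by (simp add: card_image)
    moreover have "?J = ?K"
    proof (intro set_eqI iffI)
      fix i assume "i \<in> ?J"
      then have "0 < g i" "f (Suc i) \<le> (g(i := g i - 1)) i"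
        unfolding interlaces_def by blast+
      then show "i \<in> ?K" by auto
    next
      fix i assume i: "i \<in> ?K"
      have "f (Suc j) \<le> (g(i := g i - 1)) j \<and> (g(i := g i - 1)) j \<le> f j" for j
        using i L spec [OF True, of j] by (auto intro: order_trans [OF diff_le_self])
      with i show "i \<in> ?J" by (auto simp: interlaces_def)
    qed
    moreover have "interlaces g f"
      using L True by (simp add: interlaces_def)
    ultimately show ?thesis by simp
  next
    case False
    then obtain c where c: "f c < g c" by (meson not_le)
    have ng: "\<not> interlaces g f" using c by (meson interlaces_def not_le)
    show ?thesis
    proof (cases "g c = Suc (f c) \<and> (\<forall>j. j \<noteq> c \<longrightarrow> g j \<le> f j)")
      case True
      have up: "f (Suc j) \<le> f j" "g (Suc j) \<le> g j" for j
        using f(1) g(1) by (auto simp: antimono_def)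
      have "?I = {c}"
      proof (intro set_eqI iffI)
        fix i assume "i \<in> ?I"
        then have "g c \<le> add_box f i c" by (simp add: interlaces_def)
        with c show "i \<in> {c}" by (auto simp: add_box_def split: if_splits)
      next
        fix i assume "i \<in> {c}"
        have "add_box f c (Suc j) \<le> g j \<and> g j \<le> add_box f c j" for j
          using True L up(1,2) [of j] le_SucI [of "f (Suc j)" "f j"] by (cases "Suc j = c"; cases "j = c") (auto simp: add_box_def)
        with \<open>i \<in> {c}\<close> show "i \<in> ?I"
          by (simp add: interlaces_def)
      qed
      moreover have "?J = {c}"
      proof (intro set_eqI iffI)
        fix i assume "i \<in> ?J"
        then have "(g(i := g i - 1)) c \<le> f c" by (simp add: interlaces_def)
        with c show "i \<in> {c}" by (auto split: if_splits)
      next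
        fix i assume "i \<in> {c}"
        with True L up(1) show "i \<in> ?J"
          by (auto simp: interlaces_def)
      qed
      ultimately show ?thesis using ng by simp
    next
      case nT: False
      have "card ?I = 0"
      proof -
        have False if i: "interlaces g (add_box f i)" for i
        proof -
          have le: "g j \<le> add_box f i j" for j using i by (simp add: interlaces_def)
          have "i = c" using le [of c] c by (auto simp: add_box_def split: if_splits)
          then show False using nT le c unfolding add_box_def
            by (metis fun_upd_apply le_antisym less_eq_Suc_le)
        qed
        then have "?I = {}" by blast
        then show ?thesis by (simp only: card.empty)
      qed
      moreover have "card ?J = 0"
      proof -
        have False if "0 < g i" and i: "interlaces (g(i := g i - 1)) f" for i
        proof -
          have le: "(g(i := g i - 1)) j \<le> f j" for j using i by (simp add: interlaces_def)
          have "i = c" using le [of c] c by (auto split: if_splits)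
          then have "g c = Suc (f c)" using le [of c] c by simp
          moreover have "g j \<le> f j" if "j \<noteq> c" for j
            using le [of j] that \<open>i = c\<close> by simp
          ultimately show False using nT by blast
        qed
        then have "?J = {}" by blast
        then show ?thesis by (simp only: card.empty)
      qed
      ultimately show ?thesis using ng by simp
    qed
  qed
next
  case False
  then obtain j where j: "g j < f (Suc j)" by (meson not_le)
  have "\<not> interlaces g (add_box f i)" "\<not> interlaces (g(i := g i - 1)) f" "\<not> interlaces g f" for i
    using j by (auto simp: interlaces_def add_box_def not_le intro!: exI [of _ j])
  then show ?thesis by simp
qed

definition horizontal_strip :: "nat list \<Rightarrow> nat list \<Rightarrow> bool" where
  "horizontal_strip m l \<longleftrightarrow> interlaces (part m) (part l)"

lemma one_box_below_horizontal_strip: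
  assumes "m \<in> all_partitions" "l \<in> all_partitions" "one_box_below m l"
  shows "horizontal_strip m l"
  using assms antimono_add_box_interlaces antimono_part
  unfolding one_box_below_iff horizontal_strip_def by metis

lemma horizontal_strip_subset: "horizontal_strip m l \<Longrightarrow> diagram m \<subseteq> diagram l"
  by (simp add: horizontal_strip_def interlaces_def diagram_mono_iff)

lemma horizontal_strip_one_box:
  assumes "horizontal_strip m l" "sum_list m + 1 = sum_list l"
  shows "one_box_below m l"
  using assms horizontal_strip_subset [OF assms(1)]
  unfolding one_box_below_def
  by (metis add_diff_cancel_left' card_Diff_subset card_diagram finite_diagram)

text \<open>
  The operator form of this identity is $h_r^\perp h_1 = h_1 h_r^\perp + h_{r-1}^\perp$:
  the left side adds a box to $l$ and then removes a horizontal strip to reach $p$, the right side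
  removes a horizontal strip first, or removes a strip that is one box shorter.
\<close>

lemma switch_box_strip:
  assumes "l \<in> all_partitions" "p \<in> all_partitions"
  shows "card {q \<in> all_partitions. one_box_below l q \<and> horizontal_strip p q}
       = card {m \<in> all_partitions. one_box_below m p \<and> horizontal_strip m l}
         + (if horizontal_strip p l then 1 else 0)"
proof -
  define b where "b = max (length l) (length p)"
  have b: "part l b = 0" "part p b = 0"
    by (auto simp: b_def part_def)
  have bb: "f b' = 0" if "interlaces f g" "g b' = 0" for f g b'
    using that by (metis interlaces_def le_zero_eq)
  have "bij_betw part {q \<in> all_partitions. one_box_below l q \<and> horizontal_strip p q}
     (add_box (part l) ` {i. interlaces (part p) (add_box (part l) i)})"
    unfolding bij_betw_def
  proof
    show "inj_on part {q \<in> all_partitions. one_box_below l q \<and> horizontal_strip p q}"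
      by (auto intro: inj_onI part_inject)
    have "\<exists>q. q \<in> all_partitions \<and> part q = add_box (part l) i"
      if i: "interlaces (part p) (add_box (part l) i)" for i
    proof -
      have "add_box (part l) i (Suc b) \<le> part p b"
        using i by (simp add: interlaces_def)
      then have "add_box (part l) i (Suc b) = 0"
        using b by simp
      then show ?thesis using ex_part [OF interlaces_antimono(2) [OF i]] by metis
    qed
    then show "part ` {q \<in> all_partitions. one_box_below l q \<and> horizontal_strip p q}
        = add_box (part l) ` {i. interlaces (part p) (add_box (part l) i)}"
      unfolding one_box_below_iff horizontal_strip_def image_def
      by (intro set_eqI) (simp, metis)
  qed
  then have 1: "card {q \<in> all_partitions. one_box_below l q \<and> horizontal_strip p q}
      = card {i. interlaces (part p) (add_box (part l) i)}"
    using inj_add_box by (metis (no_types, lifting) bij_betw_same_card card_image inj_on_subset subset_UNIV)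
  let ?R = "\<lambda>i. (part p)(i := part p i - 1)"
  let ?J = "{i. 0 < part p i \<and> interlaces (?R i) (part l)}"
  have "bij_betw part {m \<in> all_partitions. one_box_below m p \<and> horizontal_strip m l} (?R ` ?J)"
    unfolding bij_betw_def
  proof
    show "inj_on part {m \<in> all_partitions. one_box_below m p \<and> horizontal_strip m l}"
      by (auto intro: inj_onI part_inject)
    have 2: "part p = add_box f i \<longleftrightarrow> 0 < part p i \<and> f = ?R i" for f i
      by (auto simp: add_box_def fun_eq_iff)
    have "\<exists>m. m \<in> all_partitions \<and> part m = ?R i" if i: "interlaces (?R i) (part l)" for i
      using ex_part [OF interlaces_antimono(1) [OF i] bb [OF i b(1)]] by metis
    then show "part ` {m \<in> all_partitions. one_box_below m p \<and> horizontal_strip m l} = ?R ` ?J"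
      unfolding one_box_below_iff horizontal_strip_def 2 image_def
      by (intro set_eqI) (simp, metis)
  qed
  moreover have "inj_on ?R ?J"
  proof (rule inj_onI)
    fix i j assume "i \<in> ?J" "?R i = ?R j"
    then have "(?R i) i = (?R j) i" "0 < part p i" by simp_all
    then show "i = j"
      by (auto split: if_splits)
  qed
  ultimately have 2: "card {m \<in> all_partitions. one_box_below m p \<and> horizontal_strip m l} = card ?J"
    by (metis (no_types, lifting) bij_betw_same_card card_image)
  show ?thesis
    unfolding 1 2 unfolding horizontal_strip_def
    by (rule interlacing_switch) (use assms b antimono_part in auto)
qed

section \<open>Splitting off the last variable\<close>

lemma coeff_0 [simp]: "coeff 0 m = 0" by (simp add: zero_series_def)
lemma coeff_1: "coeff 1 m = (if m = 0 then 1 else 0)" by (simp add: one_series_def)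
lemma coeff_add [simp]: "coeff (f + g) m = coeff f m + coeff g m" by (simp add: plus_series_def)
lemma coeff_sum: "coeff (sum f A) m = (\<Sum>x\<in>A. coeff (f x) m)"
  by (induction A rule: infinite_finite_induct) auto
lemma coeff_mult: "coeff (f * g) m = (\<Sum>(a, b)\<in>{(a, b). a + b = m}. coeff f a * coeff g b)"
  by (simp add: times_series_def)

text \<open>
  The coefficient of $x_N^r$ after all later variables are set to zero, as a series in the variables
  before $x_N$. Taking out the last variable, rather than the first, is what turns Schur functions
  into Schur functions of smaller shapes.
\<close>

definition slice :: "nat \<Rightarrow> nat \<Rightarrow> series \<Rightarrow> series" where
  "slice N r f = Series (\<lambda>m. if Poly_Mapping.keys m \<subseteq> {..<N}
     then coeff f (m + Poly_Mapping.single N r) else 0)"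

abbreviation trunc :: "nat \<Rightarrow> series \<Rightarrow> series" where
  "trunc N \<equiv> slice N 0"

lemma coeff_slice: "coeff (slice N r f) m = (if Poly_Mapping.keys m \<subseteq> {..<N}
     then coeff f (m + Poly_Mapping.single N r) else 0)"
  by (simp add: slice_def)

lemma slice_add: "slice N r (f + g) = slice N r f + slice N r g"
  by (rule series_eqI) (simp add: coeff_slice)

lemma slice_0 [simp]: "slice N r 0 = 0"
  by (rule series_eqI) (simp add: coeff_slice)

lemma slice_sum: "slice N r (sum f A) = (\<Sum>x\<in>A. slice N r (f x))"
  by (induction A rule: infinite_finite_induct) (auto simp: slice_add)

lemma slice_of_nat_mult: "slice N r (of_nat c * f) = of_nat c * slice N r f"
  by (induction c) (auto simp: slice_add ring_distribs)

lemma slice_1: "slice N r 1 = (if r = 0 then 1 else 0)"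
proof (rule series_eqI)
  fix m
  have "m + Poly_Mapping.single N r = 0 \<longleftrightarrow> m = 0 \<and> r = 0"
  proof
    assume *: "m + Poly_Mapping.single N r = 0"
    have "Poly_Mapping.lookup m i + Poly_Mapping.lookup (Poly_Mapping.single N r) i = 0" for i
      by (metis * lookup_add lookup_zero)
    then have "Poly_Mapping.lookup m i = 0" "Poly_Mapping.lookup (Poly_Mapping.single N r) N = 0" for i
      by (metis add_eq_0_iff_both_eq_0)+
    then show "m = 0 \<and> r = 0"
      by (auto intro: poly_mapping_eqI)
  qed simp
  then show "coeff (slice N r 1) m = coeff (if r = 0 then 1 else 0) m"
    by (auto simp: coeff_slice coeff_1)
qed

lemma keys_add_nat: "Poly_Mapping.keys (a + b :: monomial) = Poly_Mapping.keys a \<union> Poly_Mapping.keys b"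
  by (auto simp: in_keys_iff lookup_add)

lemma series_eq_trunc:
  assumes "\<And>N. trunc N f = trunc N g"
  shows "f = g"
proof (rule series_eqI)
  fix m :: monomial
  obtain N where "Poly_Mapping.keys m \<subseteq> {..<N}"
    using finite_nat_set_iff_bounded [of "Poly_Mapping.keys m"] by auto
  then show "coeff f m = coeff g m"
    using arg_cong [OF assms [of N], of "\<lambda>s. coeff s m"] by (simp add: coeff_slice)
qed

lemma split_last_variable:
  fixes m :: monomial
  assumes "Poly_Mapping.keys m \<subseteq> {..<Suc N}"
  obtains m' r where "m = m' + Poly_Mapping.single N r" "Poly_Mapping.keys m' \<subseteq> {..<N}"
proof
  let ?r = "Poly_Mapping.lookup m N"
  show "m = (m - Poly_Mapping.single N ?r) + Poly_Mapping.single N ?r"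
    by (rule poly_mapping_eqI) (auto simp: lookup_add lookup_minus lookup_single when_def)
  show "Poly_Mapping.keys (m - Poly_Mapping.single N ?r) \<subseteq> {..<N}"
  proof
    fix i assume "i \<in> Poly_Mapping.keys (m - Poly_Mapping.single N ?r)"
    then have "i \<noteq> N" "i \<in> Poly_Mapping.keys m"
      by (auto simp: in_keys_iff lookup_minus lookup_single when_def split: if_splits)
    with assms show "i \<in> {..<N}" by auto
  qed
qed

lemma trunc_Suc_eqI:
  assumes "\<And>r. slice N r f = slice N r g"
  shows "trunc (Suc N) f = trunc (Suc N) g"
proof (rule series_eqI)
  fix m
  show "coeff (trunc (Suc N) f) m = coeff (trunc (Suc N) g) m"
  proof (cases "Poly_Mapping.keys m \<subseteq> {..<Suc N}")
    case True
    then obtain m' r where m: "m = m' + Poly_Mapping.single N r" "Poly_Mapping.keys m' \<subseteq> {..<N}"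
      by (rule split_last_variable)
    then show ?thesis
      using arg_cong [OF assms [of r], of "\<lambda>s. coeff s m'"] True by (simp add: coeff_slice)
  qed (simp add: coeff_slice)
qed

lemma lookup_outside: "Poly_Mapping.keys (m :: monomial) \<subseteq> {..<N} \<Longrightarrow> Poly_Mapping.lookup m N = 0"
proof (rule ccontr)
  assume *: "Poly_Mapping.keys m \<subseteq> {..<N}" and "Poly_Mapping.lookup m N \<noteq> 0"
  then have "N \<in> Poly_Mapping.keys m" by (simp add: in_keys_iff)
  with * show False by auto
qed

text \<open>
  Write $f$ and $g$, with the variables after $x_N$ set to zero, as polynomials in $x_N$: this is the
  formula for the coefficients of a product. In particular, truncation is multiplicative.
\<close>

lemma slice_mult: "slice N r (f * g) = (\<Sum>s\<le>r. slice N s f * slice N (r - s) g)"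
proof (rule series_eqI)
  fix m
  let ?S = "\<lambda>m. {(a, b). a + b = (m :: monomial)}"
  let ?x = "Poly_Mapping.single N :: nat \<Rightarrow> monomial"
  show "coeff (slice N r (f * g)) m = coeff (\<Sum>s\<le>r. slice N s f * slice N (r - s) g) m"
  proof (cases "Poly_Mapping.keys m \<subseteq> {..<N}")
    case True
    then have mN: "Poly_Mapping.lookup m N = 0" by (rule lookup_outside)
    have sub: "Poly_Mapping.keys a \<subseteq> {..<N} \<and> Poly_Mapping.keys b \<subseteq> {..<N}"
      if "(a, b) \<in> ?S m" for a b
      using that True by (auto simp: keys_add_nat)
    have "coeff (\<Sum>s\<le>r. slice N s f * slice N (r - s) g) m
        = (\<Sum>s\<le>r. \<Sum>(a, b)\<in>?S m. coeff f (a + ?x s) * coeff g (b + ?x (r - s)))"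
      unfolding coeff_sum coeff_mult
      by (intro sum.cong refl) (use sub in \<open>auto simp: coeff_slice\<close>)
    also have "\<dots> = (\<Sum>(s, a, b)\<in>{..r} \<times> ?S m. coeff f (a + ?x s) * coeff g (b + ?x (r - s)))"
      by (subst sum.cartesian_product) (simp add: case_prod_beta)
    also have "\<dots> = (\<Sum>(a, b)\<in>?S (m + ?x r). coeff f a * coeff g b)"
    proof (rule sum.reindex_bij_witness
        [of _ "\<lambda>(a, b). (Poly_Mapping.lookup a N, a - ?x (Poly_Mapping.lookup a N), b - ?x (Poly_Mapping.lookup b N))"
              "\<lambda>(s, a, b). (a + ?x s, b + ?x (r - s))"]; clarsimp)
      fix s a b assume s: "s \<le> r" and m: "m = a + b"
      then have ab: "Poly_Mapping.lookup a N = 0" "Poly_Mapping.lookup b N = 0"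
        using mN by (auto simp: lookup_add)
      then show "Poly_Mapping.lookup (a + ?x s) N = s \<and>
          a + ?x s - ?x (Poly_Mapping.lookup (a + ?x s) N) = a \<and>
          b + ?x (r - s) - ?x (Poly_Mapping.lookup (b + ?x (r - s)) N) = b"
        by (simp add: lookup_add)
      show "a + ?x s + (b + ?x (r - s)) = a + b + ?x r"
        using s by (simp add: ac_simps flip: single_add)
    next
      fix a b assume ab: "a + b = m + ?x r"
      have l: "Poly_Mapping.lookup a i + Poly_Mapping.lookup b i = Poly_Mapping.lookup m i + Poly_Mapping.lookup (?x r) i" for i
        using arg_cong [OF ab, of "\<lambda>p. Poly_Mapping.lookup p i"] by (simp add: lookup_add)
      have N: "Poly_Mapping.lookup a N + Poly_Mapping.lookup b N = r"
        using l [of N] mN by simp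
      have a: "a - ?x (Poly_Mapping.lookup a N) + ?x (Poly_Mapping.lookup a N) = a" for a :: monomial
        by (rule poly_mapping_eqI) (auto simp: lookup_add lookup_minus lookup_single when_def)
      have "r - Poly_Mapping.lookup a N = Poly_Mapping.lookup b N"
        using N by simp
      then show "a - ?x (Poly_Mapping.lookup a N) + ?x (Poly_Mapping.lookup a N) = a \<and>
          b - ?x (Poly_Mapping.lookup b N) + ?x (r - Poly_Mapping.lookup a N) = b"
        using a by simp
      have "Poly_Mapping.lookup (a - ?x (Poly_Mapping.lookup a N) + (b - ?x (Poly_Mapping.lookup b N))) i
          = Poly_Mapping.lookup m i" for i
        using l [of i] mN by (auto simp: lookup_add lookup_minus lookup_single when_def split: if_splits)
      then show "Poly_Mapping.lookup a N \<le> r \<and>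
          a - ?x (Poly_Mapping.lookup a N) + (b - ?x (Poly_Mapping.lookup b N)) = m"
        using N by (auto intro: poly_mapping_eqI)
    qed
    finally show ?thesis using True by (simp add: coeff_slice coeff_mult)
  next
    case False
    then have "\<not> Poly_Mapping.keys a \<subseteq> {..<N} \<or> \<not> Poly_Mapping.keys b \<subseteq> {..<N}"
      if "(a, b) \<in> ?S m" for a b
      using that by (auto simp: keys_add_nat)
    then have "coeff (slice N s f * slice N (r - s) g) m = 0" for s
      unfolding coeff_mult by (intro sum.neutral) (auto simp: coeff_slice)
    with False show ?thesis by (simp add: coeff_slice coeff_sum)
  qed
qed

lemma trunc_mult: "trunc N (f * g) = trunc N f * trunc N g"
  by (simp add: slice_mult)

text \<open>
  The derivation $h_1^\perp = \partial/\partial p_1$ as a relation. On a symmetric function $f$, the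
  coefficient of $x_N$ is the truncation of one series $h_1^\perp f$, independently of $N$. The
  relation makes sense between arbitrary series, and a series has at most one value since
  truncations determine a series.
\<close>

definition lowers_to :: "series \<Rightarrow> series \<Rightarrow> bool" where
  "lowers_to f g \<longleftrightarrow> (\<forall>N. slice N 1 f = trunc N g)"

lemma lowers_to_unique: "lowers_to f g \<Longrightarrow> lowers_to f h \<Longrightarrow> g = h"
  unfolding lowers_to_def by (metis series_eq_trunc)

lemma lowers_to_1: "lowers_to 1 0"
  by (simp add: lowers_to_def slice_1)

lemma lowers_to_sum: "(\<And>x. x \<in> A \<Longrightarrow> lowers_to (f x) (g x)) \<Longrightarrow> lowers_to (sum f A) (sum g A)"
  by (auto simp: lowers_to_def slice_sum intro: sum.cong)

lemma lowers_to_of_nat_mult: "lowers_to f g \<Longrightarrow> lowers_to (of_nat c * f) (of_nat c * g)"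
  by (simp add: lowers_to_def slice_of_nat_mult)

text \<open>
  The Leibniz rule is the linear term of the product of two polynomials in $x_N$.
\<close>

lemma lowers_to_mult:
  assumes "lowers_to f f'" "lowers_to g g'"
  shows "lowers_to (f * g) (f' * g + f * g')"
  using assms by (simp add: lowers_to_def slice_mult slice_add add.commute)

lemma lowers_to_power:
  assumes "lowers_to f 1"
  shows "lowers_to (f ^ k) (of_nat k * f ^ (k - 1))"
proof (induction k)
  case (Suc k)
  have "lowers_to (f * f ^ k) (1 * f ^ k + f * (of_nat k * f ^ (k - 1)))"
    by (rule lowers_to_mult [OF assms Suc])
  then show ?case by (cases k) (simp_all add: algebra_simps)
qed (simp add: lowers_to_1)

section \<open>The branching rule for Schur functions\<close>

lemma coeff_schur: "coeff (schur l) m =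
    int (card {T \<in> semistandard_tableaux l. (\<Sum>c\<in>diagram l. var (T c)) = m})"
  by (simp add: schur_def monomial_sum_def)

lemma row_mono:
  assumes "T \<in> semistandard_tableaux l" "(i, j') \<in> diagram l" "j \<le> j'"
  shows "T (i, j) \<le> T (i, j')"
  using assms(3,2)
proof (induction rule: dec_induct)
  case (step k)
  then have "(i, k) \<in> diagram l" by (simp add: diagram_part)
  moreover have "T (i, k) \<le> T (i, Suc k)"
    using assms(1) step.prems by (simp add: semistandard_tableaux_def)
  ultimately show ?case using step.IH by simp
qed simp

text \<open>
  Entries increase along rows and columns, so those below the bound $N$ fill a Young diagram. Each
  column contains at most one entry $N$, since columns increase strictly; hence the rest is a
  horizontal strip.
\<close>

lemma ex_shape_below:
  assumes T: "T \<in> semistandard_tableaux l" and l: "l \<in> all_partitions" and le: "\<And>c. c \<in> diagram l \<Longrightarrow> T c \<le> N"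
  obtains m where "m \<in> all_partitions" "horizontal_strip m l" "{c \<in> diagram l. T c < N} = diagram m"
proof -
  define f where "f i = card {j. j < part l i \<and> T (i, j) < N}" for i
  have eq: "{j. j < part l i \<and> T (i, j) < N} = {..<f i}" for i
  proof -
    let ?S = "{j. j < part l i \<and> T (i, j) < N}"
    have down: "j \<in> ?S" if "j' \<in> ?S" "j \<le> j'" for j j'
      using row_mono [OF T, of i j' j] that by (auto simp: diagram_part)
    show ?thesis
    proof (cases "?S = {}")
      case True
      show ?thesis unfolding f_def True by simp
    next
      case False
      have fin: "finite ?S" by simp
      have "?S = {..Max ?S}"
      proof (intro equalityI subsetI)
        show "j \<in> {..Max ?S}" if "j \<in> ?S" for j
          using Max_ge [OF fin that] by simp
        show "j \<in> ?S" if "j \<in> {..Max ?S}" for j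
          by (rule down [OF Max_in [OF fin False]]) (use that in \<open>simp only: atMost_iff\<close>)
      qed
      then have "?S = {..<Suc (Max ?S)}" by (simp only: lessThan_Suc_atMost)
      moreover from this have "card ?S = Suc (Max ?S)" by (metis card_lessThan)
      ultimately show ?thesis unfolding f_def by simp
    qed
  qed
  have mem: "j < f i \<longleftrightarrow> j < part l i \<and> T (i, j) < N" for i j
    using eq [of i] by (auto simp: set_eq_iff)
  have inter: "interlaces f (part l)"
    unfolding interlaces_def
  proof (intro allI conjI)
    fix i
    show "f i \<le> part l i" using mem [of "part l i" i] by auto
    show "part l (Suc i) \<le> f i"
    proof (rule ccontr)
      assume "\<not> part l (Suc i) \<le> f i"
      then have d: "(Suc i, f i) \<in> diagram l" by (simp add: diagram_part)
      then have "T (i, f i) < T (Suc i, f i)" using T by (simp add: semistandard_tableaux_def)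
      moreover have "f i < part l i"
        using d antimonoD [OF antimono_part [OF l], of i "Suc i"] by (simp add: diagram_part)
      ultimately show False using le [OF d] mem [of "f i" i] by simp
    qed
  qed
  moreover have "f (length l) = 0"
    using inter by (auto simp: interlaces_def part_def dest!: spec [of _ "length l"])
  ultimately obtain m where "m \<in> all_partitions" "part m = f"
    using ex_part interlaces_antimono(1) by metis
  then show ?thesis
    using that [of m] inter mem by (auto simp: horizontal_strip_def diagram_part)
qed

lemma sum_constant_var: "(\<Sum>c\<in>C. var N) = Poly_Mapping.single N (card C)"
  by (induction C rule: infinite_finite_induct) (simp_all del: sum_constant add: single_add [symmetric])

text \<open>
  Conversely, filling a horizontal strip with $N$ extends a tableau with smaller entries to a
  semistandard one, and the number of added entries is the exponent of $x_N$.
\<close>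

lemma card_tableaux_with_shape_below:
  assumes strip: "horizontal_strip m l"
    and w: "Poly_Mapping.keys w \<subseteq> {..<N}"
  shows "card {T \<in> semistandard_tableaux l. (\<Sum>c\<in>diagram l. var (T c)) = w + Poly_Mapping.single N r
            \<and> {c \<in> diagram l. T c < N} = diagram m}
       = (if sum_list m + r = sum_list l
          then card {T \<in> semistandard_tableaux m. (\<Sum>c\<in>diagram m. var (T c)) = w} else 0)"
    (is "card ?X = (if _ then card ?Y else 0)")
proof -
  have sub: "diagram m \<subseteq> diagram l" using strip by (rule horizontal_strip_subset)
  have strip': "(i, j) \<in> diagram m" if "(Suc i, j) \<in> diagram l" for i j
    using strip that by (auto simp: horizontal_strip_def interlaces_def diagram_part
        intro: less_le_trans)
  have cont: "(\<Sum>c\<in>diagram l. var (T c))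
      = (\<Sum>c\<in>diagram m. var (T c)) + Poly_Mapping.single N (sum_list l - sum_list m)"
    if "\<And>c. c \<in> diagram l - diagram m \<Longrightarrow> T c = N" for T
  proof -
    have "(\<Sum>c\<in>diagram l - diagram m. var (T c)) = (\<Sum>c\<in>diagram l - diagram m. var N)"
      using that by (intro sum.cong) auto
    also have "\<dots> = Poly_Mapping.single N (sum_list l - sum_list m)"
      unfolding sum_constant_var by (simp add: card_Diff_subset [OF finite_diagram sub] card_diagram)
    finally show ?thesis
      using sum.subset_diff [OF sub finite_diagram, of "\<lambda>c. var (T c)"] by (simp add: add.commute)
  qed
  have small: "T c < N" if "T ` diagram m \<subseteq> {..<N}" "c \<in> diagram m" for T c
    using that by blast
  have XD: "(\<forall>c\<in>diagram l - diagram m. T c = N) \<and> (\<forall>c\<in>diagram m. T c < N)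
      \<and> (\<Sum>c\<in>diagram m. var (T c)) = w \<and> sum_list m + r = sum_list l"
    if T: "T \<in> ?X" for T
  proof -
    have "T ` diagram l = Poly_Mapping.keys (w + Poly_Mapping.single N r)"
      using T keys_sum_var [OF finite_diagram, of T l] by simp
    also have "\<dots> \<subseteq> {..N}"
      using w by (auto simp: keys_add_nat split: if_splits)
    finally have le: "T c \<le> N" if "c \<in> diagram l" for c
      using that by blast
    have shape: "diagram m = {c \<in> diagram l. T c < N}"
      using T by simp
    have N: "T c = N" if "c \<in> diagram l - diagram m" for c
      using that le [of c] shape by (metis (no_types, lifting) Diff_iff le_neq_implies_less mem_Collect_eq)
    have lt: "T c < N" if "c \<in> diagram m" for c
      using that shape by blast
    have eq: "(\<Sum>c\<in>diagram m. var (T c)) + Poly_Mapping.single N (sum_list l - sum_list m)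
        = w + Poly_Mapping.single N r"
      using cont [of T] N T by simp
    have "Poly_Mapping.keys (\<Sum>c\<in>diagram m. var (T c)) \<subseteq> {..<N}"
      using lt by (auto simp: keys_sum_var simp del: One_nat_def)
    then have "Poly_Mapping.lookup (\<Sum>c\<in>diagram m. var (T c)) N = 0"
      by (rule lookup_outside)
    then have "sum_list l - sum_list m = r"
      using arg_cong [OF eq, of "\<lambda>p. Poly_Mapping.lookup p N"] lookup_outside [OF w]
      by (simp add: lookup_add)
    moreover have "sum_list m \<le> sum_list l"
      using card_mono [OF finite_diagram sub] by (simp add: card_diagram)
    ultimately show ?thesis using eq N lt by auto
  qed
  show ?thesis
  proof (cases "sum_list m + r = sum_list l")
    case True
    \<comment> \<open>Erasing the entries $N$ and refilling the strip with $N$ are mutually inverse.\<close>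
    let ?r = "\<lambda>T. restrict T (diagram m)"
    let ?e = "\<lambda>T c. if c \<in> diagram m then T c else if c \<in> diagram l then N else undefined"
    have "bij_betw ?r ?X ?Y"
    proof (rule bij_betw_byWitness [where f' = ?e])
      show "\<forall>T\<in>?X. ?e (?r T) = T"
      proof
        fix T assume T: "T \<in> ?X"
        show "?e (?r T) = T"
        proof
          fix c
          show "?e (?r T) c = T c"
          proof (cases "c \<in> diagram l")
            case True
            then show ?thesis using conjunct1 [OF XD [OF T]] by simp
          next
            case False
            moreover have "T \<in> extensional (diagram l)"
              using T by (simp add: semistandard_tableaux_def PiE_def)
            ultimately have "T c = undefined" by (rule extensional_arb [rotated])
            moreover have "c \<notin> diagram m" using False sub by (rule contra_subsetD [rotated])
            ultimately show ?thesis using False by simp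
          qed
        qed
      qed
      show "\<forall>T\<in>?Y. ?r (?e T) = T"
      proof
        fix T assume "T \<in> ?Y"
        then have "T \<in> extensional (diagram m)" by (simp add: semistandard_tableaux_def PiE_def)
        then show "?r (?e T) = T"
          by (intro ext) (simp add: extensional_arb [of T "diagram m"])
      qed
      show "?r ` ?X \<subseteq> ?Y"
      proof (rule image_subsetI)
        fix T assume T: "T \<in> ?X"
        have "?r T \<in> semistandard_tableaux m"
          unfolding semistandard_tableaux_def mem_Collect_eq
        proof (intro conjI allI impI)
          show "?r T \<in> diagram m \<rightarrow>\<^sub>E UNIV" by simp
          fix i j
          show "?r T (i, j) \<le> ?r T (i, j + 1)" if "(i, j + 1) \<in> diagram m"
          proof -
            have "(i, j) \<in> diagram m" using that by (simp add: diagram_part)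
            moreover have "T (i, j) \<le> T (i, j + 1)"
              using T that sub by (simp add: semistandard_tableaux_def subset_iff)
            ultimately show ?thesis using that by simp
          qed
          show "?r T (i, j) < ?r T (i + 1, j)" if "(i + 1, j) \<in> diagram m"
          proof -
            have "(Suc i, j) \<in> diagram l" using that sub by auto
            then have "(i, j) \<in> diagram m" by (rule strip')
            moreover have "T (i, j) < T (i + 1, j)"
              using T that sub by (simp add: semistandard_tableaux_def subset_iff)
            ultimately show ?thesis using that by simp
          qed
        qed
        moreover have "(\<Sum>c\<in>diagram m. var (?r T c)) = w"
        proof -
          have "(\<Sum>c\<in>diagram m. var (?r T c)) = (\<Sum>c\<in>diagram m. var (T c))"
            by (rule sum.cong) (simp_all only: restrict_apply if_True)
          then show ?thesis using XD [OF T] by simp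
        qed
        ultimately show "?r T \<in> ?Y" by simp
      qed
      show "?e ` ?Y \<subseteq> ?X"
      proof (rule image_subsetI)
        fix T assume T: "T \<in> ?Y"
        have img: "T ` diagram m \<subseteq> {..<N}"
          using T w keys_sum_var [OF finite_diagram, of T m] by auto
        have lt: "T c < N" if "c \<in> diagram m" for c using img that by blast
        have row: "T (i, j) \<le> T (i, Suc j)" if "(i, Suc j) \<in> diagram m" for i j
          using T that by (simp add: semistandard_tableaux_def)
        have col: "T (i, j) < T (Suc i, j)" if "(Suc i, j) \<in> diagram m" for i j
          using T that by (simp add: semistandard_tableaux_def)
        have "?e T \<in> semistandard_tableaux l"
          unfolding semistandard_tableaux_def mem_Collect_eq
        proof (intro conjI allI impI)
          show "?e T \<in> diagram l \<rightarrow>\<^sub>E UNIV"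
            using sub by (auto simp: PiE_iff extensional_def)
          fix i j
          show "?e T (i, j) \<le> ?e T (i, j + 1)" if "(i, j + 1) \<in> diagram l"
          proof (cases "(i, j + 1) \<in> diagram m")
            case True
            then have "(i, j) \<in> diagram m" by (simp add: diagram_part)
            with True row show ?thesis by simp
          next
            case False
            have "(i, j) \<in> diagram l" using that by (simp add: diagram_part)
            with False that lt show ?thesis by (simp add: less_imp_le)
          qed
          show "?e T (i, j) < ?e T (i + 1, j)" if "(i + 1, j) \<in> diagram l"
            using that strip' [of i j] col lt by simp
        qed
        moreover have "{c \<in> diagram l. ?e T c < N} = diagram m"
          using lt sub by auto
        moreover have "(\<Sum>c\<in>diagram l. var (?e T c)) = w + Poly_Mapping.single N r"
        proof -
          have "(\<Sum>c\<in>diagram l. var (?e T c))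
              = (\<Sum>c\<in>diagram m. var (?e T c)) + Poly_Mapping.single N (sum_list l - sum_list m)"
            by (rule cont) simp
          also have "(\<Sum>c\<in>diagram m. var (?e T c)) = (\<Sum>c\<in>diagram m. var (T c))"
            by (rule sum.cong) auto
          also have "\<dots> = w" using T by simp
          also have "sum_list l - sum_list m = r" using True by simp
          finally show ?thesis .
        qed
        ultimately show "?e T \<in> ?X" by simp
      qed
    qed
    then show ?thesis using True by (simp add: bij_betw_same_card)
  next
    case False
    then have "?X = {}" using XD by blast
    then have "card ?X = 0" by (simp only: card.empty)
    with False show ?thesis by (simp only: if_False)
  qed
qed

definition strips_below :: "nat \<Rightarrow> nat list \<Rightarrow> nat list set" where
  "strips_below r l = {m \<in> all_partitions. horizontal_strip m l \<and> sum_list m + r = sum_list l}"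

lemma finite_strips_below [simp]: "finite (strips_below r l)"
  by (rule finite_subset [OF _ finite_partitions [of "sum_list l - r"]])
     (auto simp: strips_below_def partitions_eq)

text \<open>
  The branching rule $h_r^\perp s_\lambda = \sum_\mu s_\mu$, the sum over horizontal strips
  $\lambda/\mu$ of size $r$: classify the tableaux of shape $\lambda$ by the shape of the entries
  below $N$.
\<close>

lemma slice_schur:
  assumes l: "l \<in> all_partitions"
  shows "slice N r (schur l) = (\<Sum>m\<in>strips_below r l. trunc N (schur m))"
proof (rule series_eqI)
  fix w
  show "coeff (slice N r (schur l)) w = coeff (\<Sum>m\<in>strips_below r l. trunc N (schur m)) w"
  proof (cases "Poly_Mapping.keys w \<subseteq> {..<N}")
    case True
    define X where "X = {T \<in> semistandard_tableaux l. (\<Sum>c\<in>diagram l. var (T c)) = w + Poly_Mapping.single N r}"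
    define S where "S m = {T \<in> semistandard_tableaux l. (\<Sum>c\<in>diagram l. var (T c)) = w + Poly_Mapping.single N r
            \<and> {c \<in> diagram l. T c < N} = diagram m}" for m
    have finX: "finite X" unfolding X_def by (rule finite_semistandard_content)
    have SX: "S m \<subseteq> X" for m by (auto simp: S_def X_def)
    have finS: "finite (S m)" for m by (rule finite_subset [OF SX finX])
    have card_S: "card (S m) = (if sum_list m + r = sum_list l
          then card {T \<in> semistandard_tableaux m. (\<Sum>c\<in>diagram m. var (T c)) = w} else 0)"
      if "horizontal_strip m l" for m
      unfolding S_def by (rule card_tableaux_with_shape_below [OF that True])
    have "X \<subseteq> (\<Union>m\<in>strips_below r l. S m)"
    proof
      fix T assume T: "T \<in> X"
      have "T ` diagram l = Poly_Mapping.keys (w + Poly_Mapping.single N r)"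
        using T keys_sum_var [OF finite_diagram, of T l] by (simp add: X_def)
      also have "\<dots> \<subseteq> {..N}"
        using True by (auto simp: keys_add_nat split: if_splits)
      finally have le: "T c \<le> N" if "c \<in> diagram l" for c
        using that by blast
      obtain m where m: "m \<in> all_partitions" "horizontal_strip m l" "{c \<in> diagram l. T c < N} = diagram m"
        by (rule ex_shape_below [of T l N]) (use T l le in \<open>auto simp: X_def\<close>)
      then have Tm: "T \<in> S m" using T by (simp add: X_def S_def)
      then have "card (S m) \<noteq> 0" using finS by auto
      then have "m \<in> strips_below r l"
        using card_S [OF m(2)] m by (auto simp: strips_below_def split: if_splits)
      with Tm show "T \<in> (\<Union>m\<in>strips_below r l. S m)" by blast
    qed
    then have "X = (\<Union>m\<in>strips_below r l. S m)" using SX by blast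
    moreover have "S m \<inter> S m' = {}" if "m \<in> strips_below r l" "m' \<in> strips_below r l" "m \<noteq> m'" for m m'
    proof -
      have "diagram m \<noteq> diagram m'"
      proof
        assume "diagram m = diagram m'"
        then have "part m = part m'"
          by (metis diagram_mono_iff le_antisym order_refl ext)
        then show False using that part_inject by (auto simp: strips_below_def)
      qed
      then show ?thesis by (auto simp: S_def)
    qed
    ultimately have "card X = (\<Sum>m\<in>strips_below r l. card (S m))"
      using card_UN_disjoint [of "strips_below r l" S] finS by simp
    also have "\<dots> = (\<Sum>m\<in>strips_below r l. card {T \<in> semistandard_tableaux m. (\<Sum>c\<in>diagram m. var (T c)) = w})"
      by (intro sum.cong refl) (simp add: card_S strips_below_def)
    finally have "int (card X) = (\<Sum>m\<in>strips_below r l. coeff (schur m) w)"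
      by (simp add: coeff_schur)
    then show ?thesis
      using True by (simp add: coeff_slice coeff_sum coeff_schur X_def)
  qed (simp add: coeff_slice coeff_sum)
qed

section \<open>Complete symmetric functions as Schur functions\<close>

definition one_row :: "nat \<Rightarrow> nat list" where
  "one_row d = (if d = 0 then [] else [d])"

lemma one_row_partition [simp]: "one_row d \<in> all_partitions"
  by (simp add: one_row_def all_partitions_def)

lemma sum_list_one_row [simp]: "sum_list (one_row d) = d"
  by (simp add: one_row_def)

lemma part_one_row: "part (one_row d) i = (if i = 0 then d else 0)"
  by (simp add: one_row_def part_def)

lemma diagram_one_row: "diagram (one_row d) = Pair 0 ` {..<d}"
  by (auto simp: diagram_part part_one_row split: if_splits)

text \<open>
  A semistandard tableau with a single row is a weakly increasing word.
\<close>

lemma schur_one_row: "schur (one_row d) = complete_sym d"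
proof (rule series_eqI)
  fix w :: monomial
  let ?X = "{T \<in> semistandard_tableaux (one_row d). (\<Sum>c\<in>diagram (one_row d). var (T c)) = w}"
  let ?Y = "{xs \<in> {xs. length xs = d \<and> sorted xs}. (\<Sum>i\<leftarrow>xs. var i) = w}"
  let ?f = "\<lambda>T. map (\<lambda>j. T (0::nat, j)) [0..<d]"
  let ?g = "\<lambda>xs c. if c \<in> diagram (one_row d) then xs ! snd c else undefined"
  have mem: "(i, j) \<in> diagram (one_row d) \<longleftrightarrow> i = 0 \<and> j < d" for i j
    by (auto simp: diagram_one_row)
  have content: "(\<Sum>c\<in>diagram (one_row d). var (T c)) = (\<Sum>i\<leftarrow>?f T. var i)" for T
    unfolding diagram_one_row
    by (subst sum.reindex) (simp_all add: inj_on_def comp_def sum_list_distinct_conv_sum_set atLeast0LessThan)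
  have gf: "?f (?g xs) = xs" if "length xs = d" for xs
    by (rule nth_equalityI) (simp_all add: that mem)
  have "bij_betw ?f ?X ?Y"
  proof (rule bij_betw_byWitness [where f' = ?g])
    show "\<forall>T\<in>?X. ?g (?f T) = T"
    proof (intro ballI ext)
      fix T :: "nat \<times> nat \<Rightarrow> nat" and c :: "nat \<times> nat"
      assume "T \<in> ?X"
      then have "T \<in> extensional (diagram (one_row d))"
        by (simp add: semistandard_tableaux_def PiE_def)
      moreover obtain i j where "c = (i, j)" by (cases c)
      ultimately show "?g (?f T) c = T c"
        using extensional_arb [of T "diagram (one_row d)" c] by (simp add: mem)
    qed
    show "\<forall>xs\<in>?Y. ?f (?g xs) = xs"
      using gf by blast
    show "?f ` ?X \<subseteq> ?Y"
    proof (rule image_subsetI)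
      fix T assume T: "T \<in> ?X"
      have "T (0, i) \<le> T (0, j)" if "i \<le> j" "j < d" for i j
        by (rule row_mono [of T "one_row d"]) (use T that in \<open>simp_all add: mem\<close>)
      then have "sorted (?f T)"
        by (simp add: sorted_iff_nth_mono)
      then show "?f T \<in> ?Y"
        using T content [of T] by simp
    qed
    show "?g ` ?Y \<subseteq> ?X"
    proof (rule image_subsetI)
      fix xs assume xs: "xs \<in> ?Y"
      then have len: "length xs = d" and "sorted xs" by simp_all
      then have "?g xs \<in> semistandard_tableaux (one_row d)"
        by (simp add: semistandard_tableaux_def mem PiE_iff extensional_def sorted_iff_nth_mono)
      then show "?g xs \<in> ?X"
        using xs content [of "?g xs"] gf [OF len] by (simp only: mem_Collect_eq simp_thms)
    qed
  qed
  then show "coeff (schur (one_row d)) w = coeff (complete_sym d) w"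
    by (simp add: coeff_schur complete_sym_def monomial_sum_def bij_betw_same_card)
qed

lemma strips_below_one_row: "strips_below r (one_row d) = (if r \<le> d then {one_row (d - r)} else {})"
proof -
  have "m = one_row (sum_list m)" if m: "m \<in> all_partitions" "horizontal_strip m (one_row d)" for m
  proof -
    have "part m i = 0" if "i \<noteq> 0" for i
      using m(2) that by (auto simp: horizontal_strip_def interlaces_def part_one_row dest: spec [of _ i])
    then have "part m = part (one_row (part m 0))"
      by (auto simp: part_one_row fun_eq_iff)
    then have "m = one_row (part m 0)" by (rule part_inject [OF m(1) one_row_partition])
    then show ?thesis by (metis sum_list_one_row)
  qed
  moreover have "horizontal_strip (one_row (d - r)) (one_row d)"
    by (simp add: horizontal_strip_def interlaces_def part_one_row)
  ultimately show ?thesis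
    by (auto simp: strips_below_def)
qed

lemma slice_complete_sym:
  "r > 0 \<Longrightarrow> slice N r (complete_sym d) = (if r \<le> d then trunc N (complete_sym (d - r)) else 0)"
  using slice_schur [OF one_row_partition, of N r d] by (simp add: strips_below_one_row schur_one_row)

lemma lowers_to_complete_sym: "lowers_to (complete_sym (Suc d)) (complete_sym d)"
  by (simp add: lowers_to_def slice_complete_sym)

lemma trunc_0_schur: "sum_list l \<noteq> 0 \<Longrightarrow> trunc 0 (schur l) = 0"
proof (rule series_eqI)
  fix w assume "sum_list l \<noteq> 0"
  then have "diagram l \<noteq> {}" by (metis card.empty card_diagram)
  have "(\<Sum>c\<in>diagram l. var (T c)) \<noteq> 0" for T
    using keys_sum_var [OF finite_diagram, of T l] \<open>diagram l \<noteq> {}\<close> by force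
  then have "coeff (schur l) 0 = 0" by (simp add: coeff_schur)
  then show "coeff (trunc 0 (schur l)) w = coeff 0 w"
    by (auto simp: coeff_slice)
qed

section \<open>Pieri's rule for one box\<close>

definition boxes_above :: "nat list \<Rightarrow> nat list set" where
  "boxes_above l = {q \<in> all_partitions. one_box_below l q}"

definition boxes_below :: "nat list \<Rightarrow> nat list set" where
  "boxes_below l = {m \<in> all_partitions. one_box_below m l}"

lemma sum_list_boxes_above: "q \<in> boxes_above l \<Longrightarrow> sum_list q = Suc (sum_list l)"
  by (auto simp: boxes_above_def dest: one_box_below_sum_list)

lemma finite_boxes_above [simp]: "finite (boxes_above l)"
  by (rule finite_subset [OF _ finite_partitions [of "Suc (sum_list l)"]])
     (auto simp: partitions_eq sum_list_boxes_above boxes_above_def dest: one_box_below_sum_list)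

lemma strips_below_1: "l \<in> all_partitions \<Longrightarrow> strips_below 1 l = boxes_below l"
  unfolding strips_below_def boxes_below_def
  using horizontal_strip_one_box one_box_below_horizontal_strip one_box_below_sum_list by metis

lemma finite_boxes_below [simp]: "l \<in> all_partitions \<Longrightarrow> finite (boxes_below l)"
  using strips_below_1 finite_strips_below by metis

lemma lowers_to_schur: "l \<in> all_partitions \<Longrightarrow> lowers_to (schur l) (\<Sum>m\<in>boxes_below l. schur m)"
  by (simp add: lowers_to_def slice_schur slice_sum flip: strips_below_1)

text \<open>
  The step of an induction on the number of variables. Since $h_1$ is linear in $x_N$, the branching
  rule writes the coefficient of $x_N^r$ in $h_1 s_\lambda$ as
  $\sum_\mu h_1 s_\mu + \sum_\nu s_\nu$ over strips of sizes $r$ and $r - 1$, in one variable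
  less; there the hypothesis rewrites the products $h_1 s_\mu$. The coefficient of $s_p$ in both
  expressions then agrees by the exchange of a box and a strip.
\<close>

lemma trunc_pieri_step:
  assumes IH: "\<And>l. l \<in> all_partitions \<Longrightarrow> trunc N (complete_sym 1 * schur l) = trunc N (\<Sum>q\<in>boxes_above l. schur q)"
    and l: "l \<in> all_partitions"
  shows "slice N r (complete_sym 1 * schur l) = slice N r (\<Sum>q\<in>boxes_above l. schur q)"
proof -
  let ?s = "\<lambda>p. trunc N (schur p)"
  \<comment> \<open>The partitions of the size left after adding a box to $l$ and removing $r$ boxes.\<close>
  define Q where "Q = {p \<in> all_partitions. sum_list p + r = Suc (sum_list l)}"
  have finQ: "finite Q"
    by (rule finite_subset [OF _ finite_partitions [of "Suc (sum_list l) - r"]])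
       (auto simp: Q_def partitions_eq)
  have le: "sum_list p \<le> sum_list q" if "horizontal_strip p q" for p q
    using card_mono [OF finite_diagram horizontal_strip_subset [OF that]] by (simp add: card_diagram)
  have "slice N r (complete_sym 1 * schur l)
      = trunc N (complete_sym 1) * slice N r (schur l) + (if r = 0 then 0 else slice N (r - 1) (schur l))"
  proof (cases r)
    case (Suc r')
    have "(\<Sum>s\<le>r. slice N s (complete_sym 1) * slice N (r - s) (schur l))
        = (\<Sum>s\<in>{0, 1}. slice N s (complete_sym 1) * slice N (r - s) (schur l))"
      by (rule sum.mono_neutral_right) (auto simp: Suc slice_complete_sym)
    then show ?thesis
      by (simp add: slice_mult Suc slice_complete_sym slice_1)
  qed (simp add: slice_mult)
  moreover have "trunc N (complete_sym 1) * slice N r (schur l)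
      = (\<Sum>p\<in>Q. of_nat (card {m \<in> all_partitions. one_box_below m p \<and> horizontal_strip m l}) * ?s p)"
  proof -
    have "trunc N (complete_sym 1) * slice N r (schur l)
        = (\<Sum>m\<in>strips_below r l. trunc N (complete_sym 1 * schur m))"
      by (simp add: slice_schur [OF l] sum_distrib_left trunc_mult)
    also have "\<dots> = (\<Sum>m\<in>strips_below r l. \<Sum>p\<in>{p \<in> Q. one_box_below m p}. ?s p)"
    proof (rule sum.cong [OF refl])
      fix m assume m: "m \<in> strips_below r l"
      then have "boxes_above m = {p \<in> Q. one_box_below m p}"
        by (auto simp: strips_below_def boxes_above_def Q_def dest: one_box_below_sum_list)
      then show "trunc N (complete_sym 1 * schur m) = (\<Sum>p\<in>{p \<in> Q. one_box_below m p}. ?s p)"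
        using m IH [of m] by (simp add: strips_below_def slice_sum)
    qed
    also have "\<dots> = (\<Sum>p\<in>Q. \<Sum>m\<in>{m \<in> strips_below r l. one_box_below m p}. ?s p)"
      by (rule sum.swap_restrict) (simp_all add: finQ)
    also have "\<dots> = (\<Sum>p\<in>Q. of_nat (card {m \<in> all_partitions. one_box_below m p \<and> horizontal_strip m l}) * ?s p)"
    proof (rule sum.cong [OF refl])
      fix p assume "p \<in> Q"
      then have "{m \<in> strips_below r l. one_box_below m p} = {m \<in> all_partitions. one_box_below m p \<and> horizontal_strip m l}"
        by (auto simp: strips_below_def Q_def dest: one_box_below_sum_list)
      then show "(\<Sum>m\<in>{m \<in> strips_below r l. one_box_below m p}. ?s p)
          = of_nat (card {m \<in> all_partitions. one_box_below m p \<and> horizontal_strip m l}) * ?s p"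
        by simp
    qed
    finally show ?thesis .
  qed
  moreover have "(if r = 0 then 0 else slice N (r - 1) (schur l))
      = (\<Sum>p\<in>Q. if horizontal_strip p l then ?s p else 0)"
  proof -
    have "(\<Sum>p\<in>Q. if horizontal_strip p l then ?s p else 0) = (\<Sum>p\<in>{p \<in> Q. horizontal_strip p l}. ?s p)"
      by (rule sum.inter_filter [OF finQ, symmetric])
    moreover have "{p \<in> Q. horizontal_strip p l} = (if r = 0 then {} else strips_below (r - 1) l)"
    proof (cases "r = 0")
      case True
      then have "sum_list p \<noteq> Suc (sum_list l) \<or> \<not> horizontal_strip p l" for p
        using le [of p l] by auto
      with True show ?thesis by (auto simp: Q_def)
    next
      case False
      then show ?thesis by (auto simp: Q_def strips_below_def)
    qed
    ultimately show ?thesis by (simp add: slice_schur [OF l])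
  qed
  moreover have "slice N r (\<Sum>q\<in>boxes_above l. schur q)
      = (\<Sum>p\<in>Q. of_nat (card {q \<in> all_partitions. one_box_below l q \<and> horizontal_strip p q}) * ?s p)"
  proof -
    have "slice N r (\<Sum>q\<in>boxes_above l. schur q) = (\<Sum>q\<in>boxes_above l. \<Sum>p\<in>{p \<in> Q. horizontal_strip p q}. ?s p)"
      unfolding slice_sum
    proof (rule sum.cong [OF refl])
      fix q assume q: "q \<in> boxes_above l"
      then have "strips_below r q = {p \<in> Q. horizontal_strip p q}"
        using sum_list_boxes_above [OF q] by (auto simp: strips_below_def Q_def)
      moreover have "q \<in> all_partitions" using q by (simp add: boxes_above_def)
      ultimately show "slice N r (schur q) = (\<Sum>p\<in>{p \<in> Q. horizontal_strip p q}. ?s p)"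
        by (simp add: slice_schur)
    qed
    also have "\<dots> = (\<Sum>p\<in>Q. \<Sum>q\<in>{q \<in> boxes_above l. horizontal_strip p q}. ?s p)"
      by (rule sum.swap_restrict) (simp_all add: finQ)
    also have "\<dots> = (\<Sum>p\<in>Q. of_nat (card {q \<in> all_partitions. one_box_below l q \<and> horizontal_strip p q}) * ?s p)"
      by (simp add: boxes_above_def conj_assoc)
    finally show ?thesis .
  qed
  moreover have "of_nat (card {q \<in> all_partitions. one_box_below l q \<and> horizontal_strip p q}) * ?s p
      = of_nat (card {m \<in> all_partitions. one_box_below m p \<and> horizontal_strip m l}) * ?s p
        + (if horizontal_strip p l then ?s p else 0)" if "p \<in> Q" for p
    using switch_box_strip [of l p] that l by (simp add: Q_def distrib_right)
  ultimately show ?thesis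
    by (simp add: sum.distrib)
qed

text \<open>
  Two series agree if all their truncations do, and truncations to $N + 1$ variables agree if the
  coefficients of all powers of the last one do.
\<close>

theorem pieri:
  assumes "l \<in> all_partitions"
  shows "complete_sym 1 * schur l = (\<Sum>q\<in>boxes_above l. schur q)"
proof -
  have "\<forall>l\<in>all_partitions. trunc N (complete_sym 1 * schur l) = trunc N (\<Sum>q\<in>boxes_above l. schur q)" for N
  proof (induction N)
    case 0
    have "trunc 0 (complete_sym 1) = 0"
      using trunc_0_schur [of "one_row 1"] by (simp add: schur_one_row)
    moreover have "trunc 0 (schur q) = 0" if "q \<in> boxes_above l" for q l
      using sum_list_boxes_above [OF that] by (intro trunc_0_schur) simp
    ultimately have "trunc 0 (complete_sym 1 * schur l) = trunc 0 (\<Sum>q\<in>boxes_above l. schur q)" for l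
      unfolding trunc_mult slice_sum by simp
    then show ?case by blast
  next
    case (Suc N)
    show ?case
    proof (rule ballI, rule trunc_Suc_eqI)
      fix l r assume "l \<in> all_partitions"
      then show "slice N r (complete_sym 1 * schur l) = slice N r (\<Sum>q\<in>boxes_above l. schur q)"
        using trunc_pieri_step Suc.IH by blast
    qed
  qed
  then show ?thesis
    by (rule series_eq_trunc [OF bspec [OF _ assms]])
qed

section \<open>Counting vacillating tableaux\<close>

lemma vacillating_tableaux_snoc:
  assumes k: "k \<ge> 1" and len: "length t = 2 * k"
  shows "t @ [q, p] \<in> vacillating_tableaux n (Suc k) p \<longleftrightarrow>
    t \<in> vacillating_tableaux n k (t ! (2 * k - 1)) \<and> q \<in> all_partitions \<and> p \<in> all_partitions \<and>
    one_box_below p q \<and> one_box_below (t ! (2 * k - 1)) q"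
proof -
  let ?t = "t @ [q, p]"
  have nth: "?t ! i = t ! i" if "i < 2 * k" for i
    using that len by (simp add: nth_append)
  have nthq: "?t ! (2 * k) = q" and nthp: "?t ! (2 * k + 1) = p"
    using len by (simp_all add: nth_append)
  have all: "(\<forall>j<Suc k. P j) \<longleftrightarrow> (\<forall>j<k. P j) \<and> P k" for P
    by (auto simp: less_Suc_eq)
  have all': "(\<forall>j. j + 1 < Suc k \<longrightarrow> P j) \<longleftrightarrow> (\<forall>j. j + 1 < k \<longrightarrow> P j) \<and> P (k - 1)" for P
  proof -
    have "j + 1 < Suc k \<longleftrightarrow> j + 1 < k \<or> j = k - 1" for j using k by auto
    then show ?thesis by blast
  qed
  have down: "(\<forall>j<Suc k. one_box_below (?t ! (2 * j + 1)) (?t ! (2 * j))) \<longleftrightarrow>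
      (\<forall>j<k. one_box_below (t ! (2 * j + 1)) (t ! (2 * j))) \<and> one_box_below p q"
    unfolding all nthq nthp by (simp add: nth del: append_Cons)
  have up: "(\<forall>j. j + 1 < Suc k \<longrightarrow> one_box_below (?t ! (2 * j + 1)) (?t ! (2 * j + 2))) \<longleftrightarrow>
      (\<forall>j. j + 1 < k \<longrightarrow> one_box_below (t ! (2 * j + 1)) (t ! (2 * j + 2))) \<and> one_box_below (t ! (2 * k - 1)) q"
  proof -
    have "2 * (k - 1) + 1 = 2 * k - 1" "2 * (k - 1) + 2 = 2 * k" using k by auto
    then have last: "one_box_below (?t ! (2 * (k - 1) + 1)) (?t ! (2 * (k - 1) + 2)) = one_box_below (t ! (2 * k - 1)) q"
      using k nthq nth [of "2 * k - 1"] by simp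
    have "j + 1 < k \<Longrightarrow> ?t ! (2 * j + 1) = t ! (2 * j + 1) \<and> ?t ! (2 * j + 2) = t ! (2 * j + 2)" for j
      using nth by simp
    then show ?thesis unfolding all' last by auto
  qed
  have ends: "?t ! 0 = t ! 0" "?t ! (2 * Suc k - 1) = p"
    using k nth [of 0] nthp by simp_all
  have par: "(\<exists>m. l \<in> partitions m) \<longleftrightarrow> l \<in> all_partitions" for l
    by (auto simp: partitions_eq)
  show ?thesis
    unfolding vacillating_tableaux_def mem_Collect_eq down up ends par
    using len by auto
qed

text \<open>
  Cut off the last two shapes: the last step down ends in $p$, and the step up before it starts in
  the shape of the shorter tableau.
\<close>

lemma vacillating_count_Suc:
  assumes k: "k \<ge> 1" and p: "p \<in> all_partitions"
  shows "vacillating_count n (Suc k) p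
    = (\<Sum>q\<in>boxes_above p. \<Sum>l\<in>boxes_below q. vacillating_count n k l)"
proof -
  let ?S = "SIGMA q:boxes_above p. SIGMA l:boxes_below q. vacillating_tableaux n k l"
  have "bij_betw (\<lambda>(q, l, t). t @ [q, p]) ?S (vacillating_tableaux n (Suc k) p)"
  proof (rule bij_betw_byWitness [where f' = "\<lambda>t. (t ! (2 * k), t ! (2 * k - 1), take (2 * k) t)"])
    have S: "length t = 2 * k \<and> t ! (2 * k - 1) = l" if "(q, l, t) \<in> ?S" for q l t
      using that by (auto simp: vacillating_tableaux_def)
    show "\<forall>x\<in>?S. (\<lambda>t. (t ! (2 * k), t ! (2 * k - 1), take (2 * k) t)) ((\<lambda>(q, l, t). t @ [q, p]) x) = x"
    proof
      fix x assume x: "x \<in> ?S"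
      obtain q l t where "x = (q, l, t)" by (cases x)
      with x S [of q l t] k show "(\<lambda>t. (t ! (2 * k), t ! (2 * k - 1), take (2 * k) t)) ((\<lambda>(q, l, t). t @ [q, p]) x) = x"
        by (simp add: nth_append)
    qed
    have T: "t = take (2 * k) t @ [t ! (2 * k), p]" "length (take (2 * k) t) = 2 * k"
      if "t \<in> vacillating_tableaux n (Suc k) p" for t
    proof -
      have len: "length t = Suc (Suc (2 * k))" and "t ! Suc (2 * k) = p"
        using that by (auto simp: vacillating_tableaux_def)
      then show "t = take (2 * k) t @ [t ! (2 * k), p]"
        using id_take_nth_drop [of "2 * k" t] by (simp add: Cons_nth_drop_Suc [symmetric])
      show "length (take (2 * k) t) = 2 * k" using len by simp
    qed
    show "\<forall>t\<in>vacillating_tableaux n (Suc k) p.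
        (\<lambda>(q, l, t). t @ [q, p]) ((\<lambda>t. (t ! (2 * k), t ! (2 * k - 1), take (2 * k) t)) t) = t"
      using T(1) by simp
    show "(\<lambda>(q, l, t). t @ [q, p]) ` ?S \<subseteq> vacillating_tableaux n (Suc k) p"
    proof (rule image_subsetI)
      fix x assume x: "x \<in> ?S"
      obtain q l t where "x = (q, l, t)" by (cases x)
      with x S [of q l t] show "(\<lambda>(q, l, t). t @ [q, p]) x \<in> vacillating_tableaux n (Suc k) p"
        using vacillating_tableaux_snoc [OF k, of t q p n] p by (simp add: boxes_above_def boxes_below_def)
    qed
    show "(\<lambda>t. (t ! (2 * k), t ! (2 * k - 1), take (2 * k) t)) ` vacillating_tableaux n (Suc k) p \<subseteq> ?S"
    proof (rule image_subsetI)
      fix t assume t: "t \<in> vacillating_tableaux n (Suc k) p"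
      define u where "u = take (2 * k) t"
      define q where "q = t ! (2 * k)"
      have u: "t = u @ [q, p]" "length u = 2 * k"
        using T [OF t] by (simp_all add: u_def q_def)
      have "u @ [q, p] \<in> vacillating_tableaux n (Suc k) p" using t u(1) by simp
      then have *: "u \<in> vacillating_tableaux n k (u ! (2 * k - 1))" "q \<in> all_partitions"
          "one_box_below p q" "one_box_below (u ! (2 * k - 1)) q"
        unfolding vacillating_tableaux_snoc [OF k u(2)] by simp_all
      have "u ! (2 * k - 1) \<in> set u" using u(2) k by simp
      then have "u ! (2 * k - 1) \<in> all_partitions"
        using *(1) by (auto simp: vacillating_tableaux_def partitions_eq)
      moreover have "t ! (2 * k - 1) = u ! (2 * k - 1)"
        using u k by (simp add: nth_append)
      ultimately show "(t ! (2 * k), t ! (2 * k - 1), take (2 * k) t) \<in> ?S"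
        using * by (simp add: boxes_above_def boxes_below_def flip: u_def q_def)
    qed
  qed
  then have "card ?S = vacillating_count n (Suc k) p"
    unfolding vacillating_count_def by (rule bij_betw_same_card)
  moreover have "card ?S = (\<Sum>q\<in>boxes_above p. \<Sum>l\<in>boxes_below q. vacillating_count n k l)"
  proof -
    have "card (SIGMA l:boxes_below q. vacillating_tableaux n k l) = (\<Sum>l\<in>boxes_below q. vacillating_count n k l)
        \<and> finite (SIGMA l:boxes_below q. vacillating_tableaux n k l)" if "q \<in> boxes_above p" for q
    proof -
      have "q \<in> all_partitions" using that by (simp add: boxes_above_def)
      then show ?thesis
        by (simp add: card_SigmaI finite_vacillating_tableaux vacillating_count_def)
    qed
    then show ?thesis by (simp add: card_SigmaI)
  qed
  ultimately show ?thesis by simp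
qed

lemma vacillating_count_1:
  assumes "p \<in> all_partitions" "n \<ge> 1"
  shows "vacillating_count n 1 p = (if p \<in> boxes_below (one_row n) then 1 else 0)"
proof -
  have "vacillating_tableaux n 1 p = (if p \<in> boxes_below (one_row n) then {[one_row n, p]} else {})"
  proof -
    have row: "one_row n = [n]" using assms(2) by (simp add: one_row_def)
    have par: "(\<exists>m. l \<in> partitions m) \<longleftrightarrow> l \<in> all_partitions" for l
      by (auto simp: partitions_eq)
    have "t \<in> vacillating_tableaux n 1 p \<longleftrightarrow> t = [[n], p] \<and> one_box_below p [n]" for t
    proof
      assume t: "t \<in> vacillating_tableaux n 1 p"
      then have "length t = Suc (Suc 0)" "t ! 0 = [n]" "t ! 1 = p" "one_box_below (t ! 1) (t ! 0)"
        unfolding vacillating_tableaux_def by auto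
      then show "t = [[n], p] \<and> one_box_below p [n]"
        by (auto simp: length_Suc_conv)
    next
      assume "t = [[n], p] \<and> one_box_below p [n]"
      then show "t \<in> vacillating_tableaux n 1 p"
        using assms(1) one_row_partition [of n] unfolding vacillating_tableaux_def par row by simp
    qed
    then show ?thesis
      using assms(1) unfolding boxes_below_def row by auto
  qed
  then show ?thesis by (simp add: vacillating_count_def)
qed

lemma one_box_below_first_row:
  "one_box_below m l \<Longrightarrow> part m 0 \<le> part l 0 \<and> part l 0 \<le> Suc (part m 0)"
  by (auto simp: one_box_below_iff add_box_def)

text \<open>
  Only the steps down can shorten the first row, each by one box, and there are $k$ of them. So the
  restriction to $\Lambda_{n-1}^k$ omits only shapes without tableaux.
\<close>

lemma vacillating_first_row:
  assumes "t \<in> vacillating_tableaux n k l" "k \<ge> 1"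
  shows "n \<le> part l 0 + k"
proof -
  have "n \<le> part (t ! (2 * j + 1)) 0 + Suc j" if "j < k" for j
    using that
  proof (induction j)
    case 0
    have "one_box_below (t ! 1) [n]"
      using assms by (force simp: vacillating_tableaux_def)
    then show ?case using one_box_below_first_row by (fastforce simp: part_def)
  next
    case (Suc j)
    have "one_box_below (t ! (2 * j + 1)) (t ! (2 * Suc j))" "one_box_below (t ! (2 * Suc j + 1)) (t ! (2 * Suc j))"
      using assms(1) Suc.prems by (auto simp: vacillating_tableaux_def)
    from this [THEN one_box_below_first_row] show ?case using Suc by simp
  qed
  from this [of "k - 1"] have "n \<le> part (t ! (2 * (k - 1) + 1)) 0 + k"
    using assms(2) by simp
  moreover have "2 * (k - 1) + 1 = 2 * k - 1" using assms(2) by simp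
  ultimately show ?thesis using assms(1) by (simp add: vacillating_tableaux_def)
qed

section \<open>The recursion and its solution\<close>

definition tableau_sum :: "nat \<Rightarrow> nat \<Rightarrow> series" where
  "tableau_sum d k = (\<Sum>l\<in>partitions d. of_nat (vacillating_count (Suc d) k l) * schur l)"

lemma tableau_sum_1: "tableau_sum d 1 = complete_sym d"
proof -
  have "boxes_below (one_row (Suc d)) = {one_row d}"
    using strips_below_1 [OF one_row_partition] strips_below_one_row [of 1 "Suc d"] by simp
  then have "vacillating_count (Suc d) 1 l = (if l = one_row d then 1 else 0)" if "l \<in> partitions d" for l
    using that vacillating_count_1 [of l "Suc d"] by (simp add: partitions_eq)
  then have "tableau_sum d 1 = (\<Sum>l\<in>partitions d. if l = one_row d then schur l else 0)"
    unfolding tableau_sum_def by (intro sum.cong) auto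
  also have "\<dots> = schur (one_row d)"
  proof -
    have "one_row d \<in> partitions d" by (simp add: partitions_eq)
    then show ?thesis by (simp add: sum.delta)
  qed
  finally show ?thesis by (simp add: schur_one_row)
qed

text \<open>
  A step up followed by a step down is multiplication by $h_1$ (Pieri's rule) followed by
  $h_1^\perp$ (the branching rule).
\<close>

lemma tableau_sum_Suc:
  assumes k: "k \<ge> 1"
  shows "lowers_to (complete_sym 1 * tableau_sum d k) (tableau_sum d (Suc k))"
proof -
  let ?c = "\<lambda>l. of_nat (vacillating_count (Suc d) k l) :: series"
  let ?Q = "partitions (Suc d)"
  have above: "boxes_above l = {q \<in> ?Q. one_box_below l q}" if "l \<in> partitions d" for l
    using that by (auto simp: boxes_above_def partitions_eq dest: one_box_below_sum_list)
  have below: "boxes_below q = {l \<in> partitions d. one_box_below l q}" if "q \<in> ?Q" for q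
    using that by (auto simp: boxes_below_def partitions_eq dest: one_box_below_sum_list)
  have "complete_sym 1 * tableau_sum d k = (\<Sum>l\<in>partitions d. ?c l * (complete_sym 1 * schur l))"
    by (simp add: tableau_sum_def sum_distrib_left mult.left_commute)
  also have "\<dots> = (\<Sum>l\<in>partitions d. \<Sum>q\<in>{q \<in> ?Q. one_box_below l q}. ?c l * schur q)"
  proof (rule sum.cong [OF refl])
    fix l assume l: "l \<in> partitions d"
    then have "l \<in> all_partitions" by (simp add: partitions_eq)
    then show "?c l * (complete_sym 1 * schur l) = (\<Sum>q\<in>{q \<in> ?Q. one_box_below l q}. ?c l * schur q)"
      by (simp only: pieri above [OF l] sum_distrib_left)
  qed
  also have "\<dots> = (\<Sum>q\<in>?Q. \<Sum>l\<in>{l \<in> partitions d. one_box_below l q}. ?c l * schur q)"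
    by (rule sum.swap_restrict) simp_all
  also have "\<dots> = (\<Sum>q\<in>?Q. of_nat (\<Sum>l\<in>boxes_below q. vacillating_count (Suc d) k l) * schur q)"
    by (intro sum.cong refl) (simp add: below sum_distrib_right)
  finally have "lowers_to (complete_sym 1 * tableau_sum d k)
      (\<Sum>q\<in>?Q. of_nat (\<Sum>l\<in>boxes_below q. vacillating_count (Suc d) k l) * (\<Sum>p\<in>boxes_below q. schur p))"
    by (simp only:) (intro lowers_to_sum lowers_to_of_nat_mult lowers_to_schur, simp add: partitions_eq)
  also have "(\<Sum>q\<in>?Q. of_nat (\<Sum>l\<in>boxes_below q. vacillating_count (Suc d) k l) * (\<Sum>p\<in>boxes_below q. schur p))
      = (\<Sum>q\<in>?Q. \<Sum>p\<in>{p \<in> partitions d. one_box_below p q}. of_nat (\<Sum>l\<in>boxes_below q. vacillating_count (Suc d) k l) * schur p)"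
    by (intro sum.cong refl) (simp add: below sum_distrib_left)
  also have "\<dots> = (\<Sum>p\<in>partitions d. \<Sum>q\<in>{q \<in> ?Q. one_box_below p q}. of_nat (\<Sum>l\<in>boxes_below q. vacillating_count (Suc d) k l) * schur p)"
    by (rule sum.swap_restrict) simp_all
  also have "\<dots> = tableau_sum d (Suc k)"
    unfolding tableau_sum_def
  proof (intro sum.cong refl)
    fix p assume p: "p \<in> partitions d"
    then have "p \<in> all_partitions" by (simp add: partitions_eq)
    then show "(\<Sum>q\<in>{q \<in> ?Q. one_box_below p q}. of_nat (\<Sum>l\<in>boxes_below q. vacillating_count (Suc d) k l) * schur p)
        = of_nat (vacillating_count (Suc d) (Suc k) p) * schur p"
      by (simp add: vacillating_count_Suc [OF k] above [OF p] sum_distrib_right)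
  qed
  finally show ?thesis .
qed

text \<open>
  Both indices are shifted by one: for $n = d + 1$ and $j = i + 1$ this is $h_{(n-j,1^{j-1})}$. The value $0$
  for $i > d$ plays the part of $h_{-1}$ in the recursion, which cuts off the sum at $j = n$.
\<close>

definition hook_product :: "nat \<Rightarrow> nat \<Rightarrow> series" where
  "hook_product d i = (if i \<le> d then complete_sym (d - i) * complete_sym 1 ^ i else 0)"

text \<open>
  Leibniz on $h_{d-i} h_1^{i+1}$: the power contributes the factor $i + 1$, and $h_{d-i}$ drops to
  $h_{d-i-1}$.
\<close>

lemma lowers_to_hook_product:
  "lowers_to (complete_sym 1 * hook_product d i)
     (of_nat (Suc i) * hook_product d i + hook_product d (Suc i))"
proof -
  have "lowers_to (complete_sym 1) 1"
    using lowers_to_complete_sym [of 0] by simp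
  then have pow: "lowers_to (complete_sym 1 ^ Suc i) (of_nat (Suc i) * complete_sym 1 ^ i)"
    using lowers_to_power [of "complete_sym 1" "Suc i"] by simp
  consider "i < d" | "i = d" | "i > d" by linarith
  then show ?thesis
  proof cases
    case 1
    then have "lowers_to (complete_sym (d - i)) (complete_sym (d - Suc i))"
      using lowers_to_complete_sym [of "d - Suc i"] by (simp add: Suc_diff_Suc)
    from lowers_to_mult [OF this pow] 1 show ?thesis
      by (simp add: hook_product_def algebra_simps)
  next
    case 2
    with pow show ?thesis by (simp add: hook_product_def)
  next
    case 3
    then show ?thesis by (simp add: hook_product_def lowers_to_def)
  qed
qed

text \<open>
  The coefficients $i + 1$ and $1$ are those of the recurrence
  $S(k+1,i+1) = (i+1)\,S(k,i+1) + S(k,i)$.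
\<close>

lemma tableau_sum_eq:
  "tableau_sum d (Suc k) = (\<Sum>i\<le>k. of_nat (Stirling (Suc k) (Suc i)) * hook_product d i)"
proof (induction k)
  case 0
  then show ?case using tableau_sum_1 [of d] by (simp add: hook_product_def)
next
  case (Suc k)
  let ?S = "\<lambda>i. of_nat (Stirling (Suc k) i) :: series"
  let ?E = "hook_product d"
  have "complete_sym 1 * tableau_sum d (Suc k) = (\<Sum>i\<le>k. ?S (Suc i) * (complete_sym 1 * ?E i))"
    by (simp only: Suc sum_distrib_left mult.left_commute)
  then have "lowers_to (complete_sym 1 * tableau_sum d (Suc k))
      (\<Sum>i\<le>k. ?S (Suc i) * (of_nat (Suc i) * ?E i + ?E (Suc i)))"
    by (simp only:) (intro lowers_to_sum lowers_to_of_nat_mult lowers_to_hook_product)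
  moreover have "lowers_to (complete_sym 1 * tableau_sum d (Suc k)) (tableau_sum d (Suc (Suc k)))"
    by (rule tableau_sum_Suc) simp
  ultimately have "tableau_sum d (Suc (Suc k)) = (\<Sum>i\<le>k. ?S (Suc i) * (of_nat (Suc i) * ?E i + ?E (Suc i)))"
    using lowers_to_unique by blast
  also have "\<dots> = (\<Sum>i\<le>k. of_nat (Suc i) * ?S (Suc i) * ?E i) + (\<Sum>i\<le>k. ?S (Suc i) * ?E (Suc i))"
    by (simp only: distrib_left sum.distrib mult.left_commute mult.assoc)
  also have "(\<Sum>i\<le>k. of_nat (Suc i) * ?S (Suc i) * ?E i) = (\<Sum>i\<le>Suc k. of_nat (Suc i) * ?S (Suc i) * ?E i)"
    by (simp add: Stirling_less)
  also have "(\<Sum>i\<le>k. ?S (Suc i) * ?E (Suc i)) = (\<Sum>i\<le>Suc k. ?S i * ?E i)"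
    unfolding sum.atMost_Suc_shift by simp
  also have "(\<Sum>i\<le>Suc k. of_nat (Suc i) * ?S (Suc i) * ?E i) + (\<Sum>i\<le>Suc k. ?S i * ?E i)
      = (\<Sum>i\<le>Suc k. of_nat (Stirling (Suc (Suc k)) (Suc i)) * ?E i)"
    unfolding sum.distrib [symmetric] Stirling.simps(4) [of "Suc k"] of_nat_add of_nat_mult distrib_right ..
  finally show ?case .
qed

theorem theorem13:
  fixes n k :: nat
  assumes "n \<ge> 1" and "k \<ge> 1"
  shows "(\<Sum>l\<in>Lambda (n - 1) k. of_nat (vacillating_count n k l) * schur l)
       = (\<Sum>j = 1..min n k. of_nat (Stirling k j) * complete_sym_partition (near_hook n j))"
proof -
  obtain d where n: "n = Suc d" using assms(1) by (cases n) auto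
  obtain k' where k: "k = Suc k'" using assms(2) by (cases k) auto
  have "(\<Sum>l\<in>Lambda (n - 1) k. of_nat (vacillating_count n k l) * schur l) = tableau_sum d k"
    unfolding tableau_sum_def n diff_Suc_1
  proof (rule sum.mono_neutral_left)
    show "\<forall>l\<in>partitions d - Lambda d k. of_nat (vacillating_count (Suc d) k l) * schur l = 0"
    proof
      fix l assume l: "l \<in> partitions d - Lambda d k"
      have "first_part l = part l 0"
        by (simp add: first_part_def part_def hd_conv_nth)
      then have "part l 0 + k < Suc d"
        using l by (auto simp: Lambda_def)
      then have "vacillating_tableaux (Suc d) k l = {}"
        using vacillating_first_row [of _ "Suc d" k l] assms(2) by fastforce
      then show "of_nat (vacillating_count (Suc d) k l) * schur l = 0"
        by (simp add: vacillating_count_def)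
    qed
  qed (auto simp: Lambda_def)
  also have "\<dots> = (\<Sum>i\<le>k'. of_nat (Stirling k (Suc i)) * hook_product d i)"
    unfolding k by (rule tableau_sum_eq)
  also have "\<dots> = (\<Sum>i\<le>min d k'. of_nat (Stirling k (Suc i)) * hook_product d i)"
    by (rule sum.mono_neutral_right) (auto simp: hook_product_def)
  also have "\<dots> = (\<Sum>i\<le>min d k'. of_nat (Stirling k (Suc i)) * complete_sym_partition (near_hook n (Suc i)))"
    by (intro sum.cong refl) (simp add: n hook_product_def complete_sym_near_hook)
  also have "\<dots> = (\<Sum>j = 1..min n k. of_nat (Stirling k j) * complete_sym_partition (near_hook n j))"
    by (rule sum.reindex_bij_witness [of _ "\<lambda>j. j - 1" Suc]) (auto simp: n k)
  finally show ?thesis .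
qed

end
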